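(* Let $N$ be a finite set with $|N|=n\geq 2$ and let $P\subseteq\mathbb{R}^N$ be a standardized generalized permutohedron. Let $x\in\mathbb{R}^{\Gamma\times N}$ ($\Gamma$ a finite index set) be an array whose set of rows $\{x(\tau,\ast):\tau\in\Gamma\}$ is exactly the vertex set of $P$. For $\tau\in\Gamma$ put $N_\tau:=\{i\in N:x(\tau,i)=0\}$ and $\mathcal{S}_\tau:=\{S\subseteq N:\sum_{i\in S}x(\tau,i)\leq\sum_{i\in S}x(\pi,i)\text{ for all }\pi\in\Gamma\}$, and consider the linear system on $y\in\mathbb{R}^{\Gamma\times N}$: (a) $y(\tau,i)=0$ for all $\tau\in\Gamma$, $i\in N_\tau$; (b) $\sum_{i\in S}y(\tau,i)=\sum_{i\in S}y(\pi,i)$ for all $S\subseteq N$ and $\tau,\pi\in\Gamma$ with $S\in\mathcal{S}_\tau\cap\mathcal{S}_\pi$. Then: (1) $P$ is indecomposable if and only if every solution $y$ of (a)–(b) is a real multiple of $x$; (2) if $P$ is indecomposable, then the only standardized generalized permutohedra equivalent to $P$ are the multiples $\lambda P$ with $\lambda>0$; (3) there are only finitely many indecomposable standardized generalized permutohedra in $\mathbb{R}^N$ up to multiplication by positive scalars, and every generalized permutohedron in $\mathbb{R}^N$ can be written as a Minkowski sum of indecomposable generalized permutohedra.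
   Context: $\Upsilon$ denotes the set of bijections $\pi:\{1,\dots,n\}\to N$; $\chi_i$ is the $i$-th unit vector of $\mathbb{R}^N$. A generalized permutohedron is a polytope $\mathrm{conv}\{v_\pi:\pi\in\Upsilon\}$ where $\{v_\pi\}_{\pi\in\Upsilon}\subseteq\mathbb{R}^N$ satisfies: for every $\pi\in\Upsilon$ and every adjacent transposition $\sigma$ of $\{1,\dots,n\}$ exchanging $\ell,\ell+1$ ($1\le\ell<n$) there is $k_{\pi,\ell}\geq0$ with $v_\pi-v_{\pi\circ\sigma}=k_{\pi,\ell}(\chi_{\pi(\ell)}-\chi_{\pi(\ell+1)})$. The Minkowski sum is $P\oplus Q:=\{p+q:p\in P,q\in Q\}$. A polytope $P$ is a Minkowski summand of a polytope $Q$ if there are $\lambda>0$ and a polytope $R$ with $\lambda Q=P\oplus R$. For generalized permutohedra write $P\preceq Q$ if $P$ is a Minkowski summand of $Q$, and call $P,Q$ equivalent if $P\preceq Q\preceq P$. A generalized permutohedron $P$ has a non-trivial decomposition if $\lambda P=P_1\oplus\dots\oplus P_k$ for some $\lambda>0$ and generalized permutohedra $P_1,\dots,P_k$ none of which is equivalent to $P$; otherwise $P$ is indecomposable. A polytope $P$ is standardized if $P\subseteq[0,\infty)^N$ and for every $i\in N$ there exists $v\in P$ with $v_i=0$. *)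

theory Defs
  imports "HOL-Analysis.Analysis"
begin

text \<open>
  The ground set \<open>N\<close> is the type \<open>'n\<close>, so that \<open>\<real>\<^sup>N\<close> is \<open>real ^ 'n\<close> and \<open>n = CARD('n)\<close>.
  Minkowski sums are the library's \<open>+\<close> on sets, \<open>\<lambda>P\<close> is \<open>(*\<^sub>R) \<lambda> ` P\<close>, and vertices are
  extreme points.
\<close>

text \<open>
  Enumerations are required to be \<open>undefined\<close> outside \<open>{1..n}\<close>; otherwise one bijection
  \<open>{1..n} \<rightarrow> N\<close> would be represented by many functions, to which a family indexed by
  enumerations could assign different points.  Precomposition with a permutation of \<open>{1..n}\<close>
  preserves this property.
\<close>
definition enumerations :: "(nat \<Rightarrow> 'n::finite) set" where
  "enumerations = {\<pi> \<in> extensional {1..CARD('n)}. bij_betw \<pi> {1..CARD('n)} UNIV}"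

definition generalized_permutohedron :: "(real ^ 'n::finite) set \<Rightarrow> bool" where
  "generalized_permutohedron P \<longleftrightarrow>
     (\<exists>v :: (nat \<Rightarrow> 'n) \<Rightarrow> real ^ 'n.
        (\<forall>\<pi> \<in> enumerations. \<forall>l. 1 \<le> l \<and> l < CARD('n) \<longrightarrow>
           (\<exists>k\<ge>0. v \<pi> - v (\<pi> \<circ> Transposition.transpose l (l + 1)) =
                    k *\<^sub>R (axis (\<pi> l) 1 - axis (\<pi> (l + 1)) 1))) \<and>
        P = convex hull (v ` enumerations))"

definition minkowski_summand :: "'a::real_vector set \<Rightarrow> 'a set \<Rightarrow> bool" where
  "minkowski_summand P Q \<longleftrightarrow>
     polytope P \<and> polytope Q \<and> (\<exists>c>0. \<exists>R. polytope R \<and> (*\<^sub>R) c ` Q = P + R)"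

definition summand_equivalent :: "'a::real_vector set \<Rightarrow> 'a set \<Rightarrow> bool" where
  "summand_equivalent P Q \<longleftrightarrow> minkowski_summand P Q \<and> minkowski_summand Q P"

text \<open>
  The list of summands has to be nonempty: the empty sum is \<open>{0}\<close>, which would otherwise
  count as decomposable.
\<close>
definition has_nontrivial_decomposition :: "(real ^ 'n::finite) set \<Rightarrow> bool" where
  "has_nontrivial_decomposition P \<longleftrightarrow>
     (\<exists>c>0. \<exists>Qs. Qs \<noteq> [] \<and>
        (\<forall>Q \<in> set Qs. generalized_permutohedron Q \<and> \<not> summand_equivalent Q P) \<and>
        (*\<^sub>R) c ` P = sum_list Qs)"

definition indecomposable_gp :: "(real ^ 'n::finite) set \<Rightarrow> bool" where
  "indecomposable_gp P \<longleftrightarrow>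
     generalized_permutohedron P \<and> \<not> has_nontrivial_decomposition P"

definition standardized :: "(real ^ 'n::finite) set \<Rightarrow> bool" where
  "standardized P \<longleftrightarrow>
     polytope P \<and> (\<forall>v \<in> P. \<forall>i. 0 \<le> v $ i) \<and> (\<forall>i. \<exists>v \<in> P. v $ i = 0)"

definition null_set :: "('g \<Rightarrow> real ^ 'n::finite) \<Rightarrow> 'g \<Rightarrow> 'n set" where
  "null_set x \<tau> = {i. x \<tau> $ i = 0}"

definition tight_sets :: "'g set \<Rightarrow> ('g \<Rightarrow> real ^ 'n::finite) \<Rightarrow> 'g \<Rightarrow> 'n set set" where
  "tight_sets \<Gamma> x \<tau> = {S. \<forall>\<pi> \<in> \<Gamma>. (\<Sum>i\<in>S. x \<tau> $ i) \<le> (\<Sum>i\<in>S. x \<pi> $ i)}"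

text \<open>Only the rows of \<open>x\<close> and \<open>y\<close> with index in \<open>\<Gamma>\<close> are relevant.\<close>
definition solves_system ::
    "'g set \<Rightarrow> ('g \<Rightarrow> real ^ 'n::finite) \<Rightarrow> ('g \<Rightarrow> real ^ 'n) \<Rightarrow> bool" where
  "solves_system \<Gamma> x y \<longleftrightarrow>
     (\<forall>\<tau> \<in> \<Gamma>. \<forall>i \<in> null_set x \<tau>. y \<tau> $ i = 0) \<and>
     (\<forall>S. \<forall>\<tau> \<in> \<Gamma>. \<forall>\<pi> \<in> \<Gamma>. S \<in> tight_sets \<Gamma> x \<tau> \<inter> tight_sets \<Gamma> x \<pi> \<longrightarrow>
        (\<Sum>i\<in>S. y \<tau> $ i) = (\<Sum>i\<in>S. y \<pi> $ i))"

end

theory Submission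
  imports Defs
begin

text \<open>
  A vector \<open>c\<close> is sorted decreasingly by some enumeration \<open>\<pi>\<close>, and then \<open>v\<^sub>\<pi>\<close> maximizes \<open>c\<close> over
  the polytope spanned by \<open>v\<close>.  Hence the family is determined by the polytope, Minkowski sums
  are sums of families, and a Minkowski complement of one generalized permutohedron in another is
  again spanned by a family.  So generalized permutohedra form a polyhedral cone cut out by
  the inequalities \<open>k\<^sub>\<pi>\<^sub>,\<^sub>l \<ge> 0\<close>, one for each wall \<open>(\<pi>, l)\<close> of the braid arrangement, and \<open>P\<close> is a
  summand of \<open>Q\<close> iff every inequality tight at \<open>Q\<close> is tight at \<open>P\<close>.  Indecomposable
  means spanning an extreme ray modulo translations.  A face is determined by its tight
  inequalities, which gives finiteness, and decomposing repeatedly enlarges the set of tight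
  inequalities, hence terminates.  The solutions of the linear system are exactly the differences
  of standardized families in the linear span of the face of \<open>P\<close>.
\<close>

section \<open>Families indexed by enumerations, and the chambers of the braid arrangement\<close>

abbreviation swap_at :: "(nat \<Rightarrow> 'n) \<Rightarrow> nat \<Rightarrow> nat \<Rightarrow> 'n" where
  "swap_at \<pi> l \<equiv> \<pi> \<circ> Transposition.transpose l (l + 1)"

text \<open>The constant in the edge condition is forced: on a wall \<open>\<pi> l\<close> and
  \<open>\<pi> (l + 1)\<close> differ, so the difference of unit vectors has entry 1 at
  \<open>\<pi> l\<close>. Reading that entry replaces an existential by a quantity linear in
  \<open>v\<close>.\<close>

definition slope :: "((nat \<Rightarrow> 'n) \<Rightarrow> real ^ 'n::finite) \<Rightarrow> (nat \<Rightarrow> 'n) \<Rightarrow> nat \<Rightarrow> real" where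
  "slope v \<pi> l = (v \<pi> - v (swap_at \<pi> l)) $ \<pi> l"

definition walls :: "((nat \<Rightarrow> 'n::finite) \<times> nat) set" where
  "walls = enumerations \<times> {1..<CARD('n)}"

text \<open>Slopes may have either sign, so these families form a vector space containing the cone
  of \<open>gp_family\<close>. Solutions of the linear system are first placed here.\<close>

definition edge_family :: "((nat \<Rightarrow> 'n) \<Rightarrow> real ^ 'n::finite) \<Rightarrow> bool" where
  "edge_family v \<longleftrightarrow> (\<forall>(\<pi>, l) \<in> walls.
     v \<pi> - v (swap_at \<pi> l) = slope v \<pi> l *\<^sub>R (axis (\<pi> l) 1 - axis (\<pi> (l + 1)) 1))"

definition gp_family :: "((nat \<Rightarrow> 'n) \<Rightarrow> real ^ 'n::finite) \<Rightarrow> bool" where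
  "gp_family v \<longleftrightarrow> edge_family v \<and> (\<forall>(\<pi>, l) \<in> walls. 0 \<le> slope v \<pi> l)"

text \<open>The tight inequalities: for an edge family, the walls across which the assigned point
  does not change. They determine the smallest face of the cone containing \<open>v\<close>.\<close>

definition flat :: "((nat \<Rightarrow> 'n) \<Rightarrow> real ^ 'n::finite) \<Rightarrow> ((nat \<Rightarrow> 'n) \<times> nat) set" where
  "flat v = {(\<pi>, l) \<in> walls. slope v \<pi> l = 0}"

definition gp_hull :: "((nat \<Rightarrow> 'n) \<Rightarrow> real ^ 'n::finite) \<Rightarrow> (real ^ 'n) set" where
  "gp_hull v = convex hull (v ` enumerations)"

text \<open>The closed chamber of the braid arrangement belonging to \<open>\<pi>\<close>. Ties are
  allowed, so a vector on a wall is sorted by the enumerations on both sides.\<close>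

definition sorts :: "real ^ 'n::finite \<Rightarrow> (nat \<Rightarrow> 'n) \<Rightarrow> bool" where
  "sorts c \<pi> \<longleftrightarrow> (\<forall>k l. 1 \<le> k \<and> k \<le> l \<and> l \<le> CARD('n) \<longrightarrow> c $ \<pi> l \<le> c $ \<pi> k)"

definition indic :: "'n set \<Rightarrow> real ^ 'n::finite" where
  "indic S = (\<chi> i. of_bool (i \<in> S))"

lemma indic_inner: "indic S \<bullet> p = (\<Sum>i\<in>S. p $ i)"
proof -
  have "indic S \<bullet> p = (\<Sum>i\<in>UNIV. if i \<in> S then p $ i else 0)"
    unfolding indic_def inner_vec_def by (rule sum.cong) auto
  then show ?thesis
    by (simp add: sum.If_cases)
qed

subsection \<open>Enumerations\<close>

lemma enumerations_bij:
  fixes \<pi> :: "nat \<Rightarrow> 'n::finite"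
  assumes "\<pi> \<in> enumerations"
  shows "bij_betw \<pi> {1..CARD('n)} UNIV"
  using assms by (simp add: enumerations_def)

lemma enumerations_eq_iff:
  fixes \<pi> :: "nat \<Rightarrow> 'n::finite"
  assumes "\<pi> \<in> enumerations" "k \<in> {1..CARD('n)}" "l \<in> {1..CARD('n)}"
  shows "\<pi> k = \<pi> l \<longleftrightarrow> k = l"
  using enumerations_bij[OF assms(1)] assms(2,3) by (meson bij_betw_imp_inj_on inj_on_eq_iff)

lemma enumerations_obtain:
  fixes \<pi> :: "nat \<Rightarrow> 'n::finite"
  assumes "\<pi> \<in> enumerations"
  obtains k where "1 \<le> k" "k \<le> CARD('n)" "\<pi> k = i"
proof -
  have "i \<in> \<pi> ` {1..CARD('n)}"
    using enumerations_bij[OF assms] by (simp add: bij_betw_imp_surj_on)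
  then show ?thesis
    using that by auto
qed

lemma finite_enumerations: "finite (enumerations :: (nat \<Rightarrow> 'n::finite) set)"
proof (rule finite_subset)
  show "(enumerations :: (nat \<Rightarrow> 'n) set) \<subseteq> {1..CARD('n)} \<rightarrow>\<^sub>E UNIV"
    by (auto simp: enumerations_def PiE_def)
qed (simp add: finite_PiE)

lemma finite_walls: "finite (walls :: ((nat \<Rightarrow> 'n::finite) \<times> nat) set)"
  by (simp add: walls_def finite_enumerations)

lemma swap_at_enumerations:
  fixes \<pi> :: "nat \<Rightarrow> 'n::finite"
  assumes "\<pi> \<in> enumerations" "1 \<le> l" "l < CARD('n)"
  shows "swap_at \<pi> l \<in> enumerations"
proof -
  have "bij_betw (Transposition.transpose l (l + 1)) {1..CARD('n)} {1..CARD('n)}"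
    using assms by (intro bij_betw_byWitness[where f' = "Transposition.transpose l (l + 1)"])
      (auto simp: Transposition.transpose_def)
  moreover have "swap_at \<pi> l \<in> extensional {1..CARD('n)}"
    using assms by (auto simp: enumerations_def extensional_def Transposition.transpose_def)
  ultimately show ?thesis
    using enumerations_bij[OF assms(1)] bij_betw_trans unfolding enumerations_def by blast
qed

lemma exists_sorting:
  fixes c :: "real ^ 'n::finite"
  obtains \<pi> where "\<pi> \<in> enumerations" "sorts c \<pi>"
proof -
  obtain ys :: "'n list" where ys: "set ys = UNIV" "distinct ys"
    using finite_distinct_list[of "UNIV :: 'n set"] by auto
  \<comment> \<open>\<open>sort_key\<close> sorts in ascending order, hence the negated key.\<close>
  define xs where "xs = sort_key (\<lambda>i. - c $ i) ys"
  have xs: "set xs = UNIV" "distinct xs" "sorted (map (\<lambda>i. - c $ i) xs)"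
    using ys by (simp_all add: xs_def)
  have len: "length xs = CARD('n)"
    using xs distinct_card by fastforce
  \<comment> \<open>List positions start at 0 and enumerations at 1; the default
    \<open>undefined\<close> is what membership in \<open>enumerations\<close> demands.\<close>
  define \<pi> where "\<pi> = (\<lambda>k. if k \<in> {1..CARD('n)} then xs ! (k - 1) else undefined)"
  have "bij_betw (\<lambda>k. xs ! (k - 1)) {1..CARD('n)} UNIV"
  proof (rule bij_betw_trans[where f = "\<lambda>k. k - 1" and g = "(!) xs", unfolded comp_def])
    show "bij_betw (\<lambda>k. k - 1) {1..CARD('n)} {..<CARD('n)}"
      by (rule bij_betw_byWitness[where f' = Suc]) auto
    show "bij_betw ((!) xs) {..<CARD('n)} UNIV"
      using xs len by (simp add: bij_betw_nth)
  qed
  then have "bij_betw \<pi> {1..CARD('n)} UNIV"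
    by (subst bij_betw_cong[where g = "\<lambda>k. xs ! (k - 1)"]) (auto simp: \<pi>_def)
  then have "\<pi> \<in> enumerations"
    by (auto simp: enumerations_def \<pi>_def extensional_def)
  moreover have "sorts c \<pi>"
    unfolding sorts_def
  proof (intro allI impI)
    fix k l assume kl: "1 \<le> k \<and> k \<le> l \<and> l \<le> CARD('n)"
    have "- c $ (xs ! (k - 1)) \<le> - c $ (xs ! (l - 1))"
    proof -
      have "k - 1 \<le> l - 1" "l - 1 < length xs" "k - 1 < length xs"
        using kl len by auto
      then show ?thesis
        using sorted_nth_mono[OF xs(3), of "k - 1" "l - 1"] by simp
    qed
    then show "c $ \<pi> l \<le> c $ \<pi> k"
      using kl by (auto simp: \<pi>_def)
  qed
  ultimately show ?thesis
    using that by blast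
qed

lemma enumerations_nonempty: "(enumerations :: (nat \<Rightarrow> 'n::finite) set) \<noteq> {}"
  using exists_sorting[of "0 :: real ^ 'n"] by blast

lemma sorts_indic_prefix:
  fixes \<pi> :: "nat \<Rightarrow> 'n::finite"
  assumes "\<pi> \<in> enumerations" "l \<le> CARD('n)"
  shows "sorts (indic (\<pi> ` {1..l})) \<pi>"
  unfolding sorts_def
proof (intro allI impI)
  fix k m assume km: "1 \<le> k \<and> k \<le> m \<and> m \<le> CARD('n)"
  have "\<pi> k \<in> \<pi> ` {1..l}" if m: "\<pi> m \<in> \<pi> ` {1..l}"
  proof -
    obtain j where "j \<in> {1..l}" "\<pi> m = \<pi> j"
      using m by blast
    then have "m \<le> l"
      using enumerations_eq_iff[OF assms(1), of m j] km assms(2) by auto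
    then show ?thesis
      using km by auto
  qed
  then show "indic (\<pi> ` {1..l}) $ \<pi> m \<le> indic (\<pi> ` {1..l}) $ \<pi> k"
    by (auto simp: indic_def)
qed

lemma indic_prefix_diff:
  fixes \<pi> :: "nat \<Rightarrow> 'n::finite"
  assumes "\<pi> \<in> enumerations" "1 \<le> l" "l \<le> CARD('n)"
  shows "p $ \<pi> l = indic (\<pi> ` {1..l}) \<bullet> p - indic (\<pi> ` {1..l - 1}) \<bullet> p"
proof -
  have "{1..l} = insert l {1..l - 1}"
    using assms by auto
  moreover have "\<pi> l \<notin> \<pi> ` {1..l - 1}"
  proof
    assume "\<pi> l \<in> \<pi> ` {1..l - 1}"
    then obtain j where "j \<in> {1..l - 1}" "\<pi> l = \<pi> j"
      by blast
    moreover from this have "j < l"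
      using assms(2) by auto
    ultimately show False
      using enumerations_eq_iff[OF assms(1), of l j] assms(2,3) by auto
  qed
  ultimately show ?thesis
    by (simp add: indic_inner)
qed

text \<open>The prefix indicators of lengths 1 to n form a basis, because their successive
  differences are the unit vectors.\<close>

lemma prefix_inner_eq_imp_eq:
  fixes \<pi> :: "nat \<Rightarrow> 'n::finite"
  assumes "\<pi> \<in> enumerations"
    and eq: "\<And>l. l \<le> CARD('n) \<Longrightarrow> indic (\<pi> ` {1..l}) \<bullet> p = indic (\<pi> ` {1..l}) \<bullet> q"
  shows "p = q"
proof -
  have "p $ i = q $ i" for i
  proof -
    obtain l where l: "1 \<le> l" "l \<le> CARD('n)" "\<pi> l = i"
      using enumerations_obtain[OF assms(1)] by blast
    show ?thesis
      using eq[of l] eq[of "l - 1"] l indic_prefix_diff[OF assms(1) l(1,2), of p]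
        indic_prefix_diff[OF assms(1) l(1,2), of q]
      by simp
  qed
  then show ?thesis
    by (simp add: vec_eq_iff)
qed

text \<open>The chamber of \<open>\<pi>\<close> contains the basis of prefix indicators. This gives
  uniqueness of a point that maximizes all functionals sorted by \<open>\<pi>\<close>.\<close>

lemma sorts_inner_eq_imp_eq:
  fixes \<pi> :: "nat \<Rightarrow> 'n::finite"
  assumes "\<pi> \<in> enumerations" "\<And>c. sorts c \<pi> \<Longrightarrow> c \<bullet> p = c \<bullet> q"
  shows "p = q"
  by (rule prefix_inner_eq_imp_eq[OF assms(1)]) (rule assms(2)[OF sorts_indic_prefix[OF assms(1)]])

text \<open>\<open>key\<close> is the position in \<open>\<pi>\<close>, so
  \<open>key (\<rho> l)\<close> is an ascending permutation of the positions and therefore the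
  identity.\<close>

lemma no_descent_imp_eq:
  fixes \<pi> \<rho> :: "nat \<Rightarrow> 'n::finite"
  assumes \<pi>: "\<pi> \<in> enumerations" and \<rho>: "\<rho> \<in> enumerations"
    and key: "\<And>k. k \<in> {1..CARD('n)} \<Longrightarrow> key (\<pi> k) = k"
    and asc: "\<And>l. 1 \<le> l \<Longrightarrow> l < CARD('n) \<Longrightarrow> key (\<rho> l) \<le> (key (\<rho> (l + 1)) :: nat)"
  shows "\<rho> = \<pi>"
proof -
  have key_inv: "\<pi> (key i) = i" "key i \<in> {1..CARD('n)}" for i
  proof -
    obtain k where "1 \<le> k" "k \<le> CARD('n)" "\<pi> k = i"
      using enumerations_obtain[OF \<pi>] by blast
    then show "\<pi> (key i) = i" "key i \<in> {1..CARD('n)}"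
      using key[of k] by auto
  qed
  have "bij_betw key UNIV {1..CARD('n)}"
    by (rule bij_betw_byWitness[where f' = \<pi>]) (use key key_inv in auto)
  then have bij: "bij_betw (\<lambda>l. key (\<rho> l)) {1..CARD('n)} {1..CARD('n)}"
    using bij_betw_trans[OF enumerations_bij[OF \<rho>]] by (simp add: comp_def)
  have strict: "key (\<rho> l) < key (\<rho> (l + 1))" if "1 \<le> l" "l < CARD('n)" for l
  proof -
    have "\<rho> l \<noteq> \<rho> (l + 1)"
      using enumerations_eq_iff[OF \<rho>, of l "l + 1"] that by simp
    then have "key (\<rho> l) \<noteq> key (\<rho> (l + 1))"
      using key_inv(1) by metis
    then show ?thesis
      using asc[OF that] by simp
  qed
  have ge: "l \<le> key (\<rho> l)" if "1 \<le> l" "l \<le> CARD('n)" for l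
    using that
  proof (induction l rule: nat_induct_at_least)
    case base
    then show ?case
      using key_inv(2)[of "\<rho> 1"] by simp
  next
    case (Suc l)
    then show ?case
      using strict[of l] by simp
  qed
  \<comment> \<open>A permutation has the same sum as the identity, which turns the pointwise
    inequality \<open>ge\<close> into equality.\<close>
  have "(\<Sum>l = 1..CARD('n). key (\<rho> l)) = (\<Sum>l = 1..CARD('n). l)"
    using sum.reindex_bij_betw[OF bij, of "\<lambda>l. l"] by simp
  then have "key (\<rho> l) = l" if "l \<in> {1..CARD('n)}" for l
    using sum_mono_inv[of "\<lambda>l. l" "{1..CARD('n)}" "\<lambda>l. key (\<rho> l)" l] ge that by simp
  then have "\<rho> l = \<pi> l" if "l \<in> {1..CARD('n)}" for l
    using key_inv(1)[of "\<rho> l"] that by simp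
  then show ?thesis
    using \<pi> \<rho> by (intro extensionalityI[of _ "{1..CARD('n)}"]) (auto simp: enumerations_def)
qed

subsection \<open>Families satisfying the edge conditions\<close>

lemma generalized_permutohedron_iff:
  "generalized_permutohedron P \<longleftrightarrow> (\<exists>v. gp_family v \<and> P = gp_hull v)"
proof -
  have "(\<forall>\<pi> \<in> enumerations. \<forall>l. 1 \<le> l \<and> l < CARD('n) \<longrightarrow>
           (\<exists>k\<ge>0. v \<pi> - v (swap_at \<pi> l) = k *\<^sub>R (axis (\<pi> l) 1 - axis (\<pi> (l + 1)) 1)))
        \<longleftrightarrow> gp_family v" (is "?L \<longleftrightarrow> _") for v :: "(nat \<Rightarrow> 'n) \<Rightarrow> real ^ 'n"
  proof
    assume L: ?L
    have "v \<pi> - v (swap_at \<pi> l) = slope v \<pi> l *\<^sub>R (axis (\<pi> l) 1 - axis (\<pi> (l + 1)) 1) \<and>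
      0 \<le> slope v \<pi> l" if \<pi>: "\<pi> \<in> enumerations" "1 \<le> l" "l < CARD('n)" for \<pi> l
    proof -
      obtain k where k: "0 \<le> k"
        "v \<pi> - v (swap_at \<pi> l) = k *\<^sub>R (axis (\<pi> l) 1 - axis (\<pi> (l + 1)) 1)"
        using L \<pi> by blast
      have "\<pi> l \<noteq> \<pi> (l + 1)"
        using enumerations_eq_iff[OF \<pi>(1), of l "l + 1"] \<pi> by simp
      then have "slope v \<pi> l = k"
        unfolding slope_def k by (simp add: axis_def)
      then show ?thesis
        using k by simp
    qed
    then show "gp_family v"
      by (auto simp: gp_family_def edge_family_def walls_def)
  next
    assume "gp_family v"
    then show ?L
      unfolding gp_family_def edge_family_def walls_def by fastforce
  qed
  then show ?thesis
    unfolding generalized_permutohedron_def gp_hull_def by auto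
qed

lemma slope_linear:
  "slope (\<lambda>\<pi>. v \<pi> + w \<pi>) \<pi> l = slope v \<pi> l + slope w \<pi> l"
  "slope (\<lambda>\<pi>. v \<pi> - w \<pi>) \<pi> l = slope v \<pi> l - slope w \<pi> l"
  "slope (\<lambda>\<pi>. c *\<^sub>R v \<pi>) \<pi> l = c * slope v \<pi> l"
  "slope (\<lambda>\<pi>. t) \<pi> l = 0"
  by (simp_all add: slope_def algebra_simps)

lemma edge_family_linear:
  fixes v w :: "(nat \<Rightarrow> 'n::finite) \<Rightarrow> real ^ 'n"
  shows
  "edge_family v \<Longrightarrow> edge_family w \<Longrightarrow> edge_family (\<lambda>\<pi>. v \<pi> + w \<pi>)"
  "edge_family v \<Longrightarrow> edge_family w \<Longrightarrow> edge_family (\<lambda>\<pi>. v \<pi> - w \<pi>)"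
  "edge_family v \<Longrightarrow> edge_family (\<lambda>\<pi>. c *\<^sub>R v \<pi>)"
  "edge_family (\<lambda>\<pi>. t)"
proof -
  assume v: "edge_family v"
  show "edge_family (\<lambda>\<pi>. c *\<^sub>R v \<pi>)"
    unfolding edge_family_def
  proof safe
    fix \<pi> :: "nat \<Rightarrow> 'n" and l assume "(\<pi>, l) \<in> walls"
    then have "v \<pi> - v (swap_at \<pi> l) = slope v \<pi> l *\<^sub>R (axis (\<pi> l) 1 - axis (\<pi> (l + 1)) 1)"
      using v by (auto simp: edge_family_def)
    then show "c *\<^sub>R v \<pi> - c *\<^sub>R v (swap_at \<pi> l) =
        slope (\<lambda>\<pi>. c *\<^sub>R v \<pi>) \<pi> l *\<^sub>R (axis (\<pi> l) 1 - axis (\<pi> (l + 1)) 1)"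
      by (simp only: slope_linear scaleR_diff_right[symmetric] scaleR_scaleR[symmetric])
  qed
  assume w: "edge_family w"
  show "edge_family (\<lambda>\<pi>. v \<pi> + w \<pi>)"
    unfolding edge_family_def
  proof safe
    fix \<pi> :: "nat \<Rightarrow> 'n" and l assume "(\<pi>, l) \<in> walls"
    then have "v \<pi> - v (swap_at \<pi> l) = slope v \<pi> l *\<^sub>R (axis (\<pi> l) 1 - axis (\<pi> (l + 1)) 1)"
      "w \<pi> - w (swap_at \<pi> l) = slope w \<pi> l *\<^sub>R (axis (\<pi> l) 1 - axis (\<pi> (l + 1)) 1)"
      using v w by (auto simp: edge_family_def)
    then show "v \<pi> + w \<pi> - (v (swap_at \<pi> l) + w (swap_at \<pi> l)) =
        slope (\<lambda>\<pi>. v \<pi> + w \<pi>) \<pi> l *\<^sub>R (axis (\<pi> l) 1 - axis (\<pi> (l + 1)) 1)"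
      by (simp only: slope_linear scaleR_add_left add_diff_add)
  qed
  show "edge_family (\<lambda>\<pi>. v \<pi> - w \<pi>)"
    unfolding edge_family_def
  proof safe
    fix \<pi> :: "nat \<Rightarrow> 'n" and l assume "(\<pi>, l) \<in> walls"
    then have "v \<pi> - v (swap_at \<pi> l) = slope v \<pi> l *\<^sub>R (axis (\<pi> l) 1 - axis (\<pi> (l + 1)) 1)"
      "w \<pi> - w (swap_at \<pi> l) = slope w \<pi> l *\<^sub>R (axis (\<pi> l) 1 - axis (\<pi> (l + 1)) 1)"
      using v w by (auto simp: edge_family_def)
    moreover have "v \<pi> - w \<pi> - (v (swap_at \<pi> l) - w (swap_at \<pi> l)) =
        (v \<pi> - v (swap_at \<pi> l)) - (w \<pi> - w (swap_at \<pi> l))"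
      by simp
    ultimately show "v \<pi> - w \<pi> - (v (swap_at \<pi> l) - w (swap_at \<pi> l)) =
        slope (\<lambda>\<pi>. v \<pi> - w \<pi>) \<pi> l *\<^sub>R (axis (\<pi> l) 1 - axis (\<pi> (l + 1)) 1)"
      by (simp only: slope_linear scaleR_left_diff_distrib)
  qed
qed (simp add: edge_family_def slope_linear)

lemma gp_family_edge: "gp_family v \<Longrightarrow> edge_family v"
  by (simp add: gp_family_def)

lemma gp_family_slope: "gp_family v \<Longrightarrow> (\<pi>, l) \<in> walls \<Longrightarrow> 0 \<le> slope v \<pi> l"
  by (auto simp: gp_family_def)

lemma gp_family_add: "gp_family v \<Longrightarrow> gp_family w \<Longrightarrow> gp_family (\<lambda>\<pi>. v \<pi> + w \<pi>)"
  by (fastforce simp: gp_family_def slope_linear intro: edge_family_linear)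

lemma gp_family_scale: "gp_family v \<Longrightarrow> 0 \<le> c \<Longrightarrow> gp_family (\<lambda>\<pi>. c *\<^sub>R v \<pi>)"
  by (fastforce simp: gp_family_def slope_linear intro: edge_family_linear)

lemma gp_family_const: "gp_family (\<lambda>\<pi>. t)"
  by (simp add: gp_family_def slope_linear edge_family_linear)

text \<open>Bubble sort: removing a descent of \<open>\<rho>\<close> relative to \<open>\<pi>\<close> does not decrease \<open>c \<bullet> v \<rho>\<close>
  and increases the potential \<open>\<Sum>l. l * key (\<rho> l)\<close>.\<close>
lemma gp_family_greedy:
  fixes \<pi> \<rho> :: "nat \<Rightarrow> 'n::finite"
  assumes v: "gp_family v" and \<pi>: "\<pi> \<in> enumerations" and "\<rho> \<in> enumerations" and c: "sorts c \<pi>"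
  shows "c \<bullet> v \<rho> \<le> c \<bullet> v \<pi>"
proof -
  define key where "key = the_inv_into {1..CARD('n)} \<pi>"
  have key: "key (\<pi> k) = k" if "k \<in> {1..CARD('n)}" for k
    using enumerations_bij[OF \<pi>] that unfolding key_def
    by (simp add: bij_betw_imp_inj_on the_inv_into_f_f)
  have \<pi>_key: "\<pi> (key i) = i" "key i \<in> {1..CARD('n)}" for i
  proof -
    obtain k where "1 \<le> k" "k \<le> CARD('n)" "\<pi> k = i"
      using enumerations_obtain[OF \<pi>] by blast
    then show "\<pi> (key i) = i" "key i \<in> {1..CARD('n)}"
      using key[of k] by auto
  qed
  define A where "A = {\<rho>' \<in> enumerations. c \<bullet> v \<rho> \<le> c \<bullet> v \<rho>'}"
  define pot where "pot \<tau> = (\<Sum>l\<in>{1..CARD('n)}. l * key (\<tau> l))" for \<tau>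
  have A: "finite A" "A \<noteq> {}"
    using finite_enumerations assms(3) by (auto simp: A_def)
  \<comment> \<open>Instead of iterating swaps, an enumeration of maximal potential is taken among
    those at least as good as \<open>\<rho>\<close>. It has no descent, since removing one would
    raise the potential.\<close>
  then have "Max (pot ` A) \<in> pot ` A"
    by (intro Max_in) auto
  then obtain \<tau> where \<tau>: "\<tau> \<in> A" "pot \<tau> = Max (pot ` A)"
    by (auto simp: image_iff)
  have max: "pot \<tau>' \<le> pot \<tau>" if "\<tau>' \<in> A" for \<tau>'
    using that A \<tau>(2) by simp
  have \<tau>E: "\<tau> \<in> enumerations"
    using \<tau> by (simp add: A_def)
  have "key (\<tau> l) \<le> key (\<tau> (l + 1))" if l: "1 \<le> l" "l < CARD('n)" for l
  proof (rule ccontr)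
    assume desc: "\<not> ?thesis"
    have "v \<tau> - v (swap_at \<tau> l) = slope v \<tau> l *\<^sub>R (axis (\<tau> l) 1 - axis (\<tau> (l + 1)) 1)"
      using v \<tau>E l by (auto simp: gp_family_def edge_family_def walls_def)
    then have "c \<bullet> (v \<tau> - v (swap_at \<tau> l)) = slope v \<tau> l * (c $ \<tau> l - c $ \<tau> (l + 1))"
      by (simp only: inner_scaleR_right inner_diff_right[of c "axis _ _"] inner_axis) simp
    then have "c \<bullet> v \<tau> - c \<bullet> v (swap_at \<tau> l) = slope v \<tau> l * (c $ \<tau> l - c $ \<tau> (l + 1))"
      by (simp only: inner_diff_right)
    \<comment> \<open>At a descent \<open>\<pi>\<close> lists \<open>\<tau> (l + 1)\<close> before
      \<open>\<tau> l\<close>, so sortedness of \<open>c\<close> applies.\<close>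
    moreover have "c $ \<tau> l \<le> c $ \<tau> (l + 1)"
      using c desc \<pi>_key[of "\<tau> l"] \<pi>_key[of "\<tau> (l + 1)"] unfolding sorts_def
      by (metis atLeastAtMost_iff nat_le_linear)
    moreover have "0 \<le> slope v \<tau> l"
      using gp_family_slope[OF v] \<tau>E l by (simp add: walls_def)
    ultimately have "c \<bullet> v \<tau> \<le> c \<bullet> v (swap_at \<tau> l)"
      by (smt (verit, best) mult_nonneg_nonpos)
    then have "swap_at \<tau> l \<in> A"
      using \<tau> swap_at_enumerations[OF \<tau>E l] by (auto simp: A_def)
    then have le: "pot (swap_at \<tau> l) \<le> pot \<tau>"
      by (rule max)
    have split: "(\<Sum>k\<in>{1..CARD('n)}. f k) =
        (\<Sum>k\<in>{1..CARD('n)} - {l, l + 1}. f k) + (f l + f (l + 1))" for f :: "nat \<Rightarrow> nat"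
      using sum.subset_diff[of "{l, l + 1}" "{1..CARD('n)}" f] l by simp
    have "(\<Sum>k\<in>{1..CARD('n)} - {l, l + 1}. k * key (swap_at \<tau> l k)) =
        (\<Sum>k\<in>{1..CARD('n)} - {l, l + 1}. k * key (\<tau> k))"
      by (rule sum.cong) (auto simp: Transposition.transpose_def)
    then have "l * key (\<tau> (l + 1)) + (l + 1) * key (\<tau> l) \<le> l * key (\<tau> l) + (l + 1) * key (\<tau> (l + 1))"
      using le unfolding pot_def by (simp only: split) (simp add: Transposition.transpose_def)
    then show False
      using desc by simp
  qed
  then have "\<tau> = \<pi>"
    using no_descent_imp_eq[OF \<pi> \<tau>E key] by blast
  then show ?thesis
    using \<tau> by (simp add: A_def)
qed

section \<open>The greedy property characterizes families\<close>

lemma swap_at_image: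
  assumes "j \<noteq> l" "1 \<le> l"
  shows "swap_at \<pi> l ` {1..j} = \<pi> ` {1..j}"
proof -
  have "Transposition.transpose l (l + 1) ` {1..j} = {1..j}"
  proof (intro equalityI subsetI)
    fix i assume i: "i \<in> {1..j}"
    have "Transposition.transpose l (l + 1) i \<in> {1..j}"
      using i assms by (auto simp: Transposition.transpose_def)
    then show "i \<in> Transposition.transpose l (l + 1) ` {1..j}"
      by (metis image_eqI transpose_involutory)
  qed (use assms in \<open>auto simp: Transposition.transpose_def\<close>)
  then show ?thesis
    by (metis image_comp)
qed

text \<open>In the basis dual to the prefix indicators, the l-th vector is the difference of the
  unit vectors at \<open>\<pi> l\<close> and \<open>\<pi> (l + 1)\<close>. A vector killed by all
  other prefixes is a multiple of it.\<close>

lemma edge_of_prefixes: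
  fixes \<pi> :: "nat \<Rightarrow> 'n::finite"
  assumes \<pi>: "\<pi> \<in> enumerations" and l: "1 \<le> l" "l < CARD('n)"
    and d: "\<And>j. j \<le> CARD('n) \<Longrightarrow> j \<noteq> l \<Longrightarrow> indic (\<pi> ` {1..j}) \<bullet> d = 0"
  shows "d = (d $ \<pi> l) *\<^sub>R (axis (\<pi> l) 1 - axis (\<pi> (l + 1)) 1)"
    and "d $ \<pi> l = indic (\<pi> ` {1..l}) \<bullet> d"
proof -
  have dl: "d $ \<pi> l = indic (\<pi> ` {1..l}) \<bullet> d"
    using indic_prefix_diff[OF \<pi> l(1), of d] d[of "l - 1"] l by simp
  have dl1: "d $ \<pi> (l + 1) = - (d $ \<pi> l)"
    using indic_prefix_diff[OF \<pi>, of "l + 1" d] d[of "l + 1"] l dl by simp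
  have "d $ i = ((d $ \<pi> l) *\<^sub>R (axis (\<pi> l) 1 - axis (\<pi> (l + 1)) 1)) $ i" for i
  proof -
    obtain j where j: "1 \<le> j" "j \<le> CARD('n)" "\<pi> j = i"
      using enumerations_obtain[OF \<pi>] by blast
    have ne: "\<pi> l \<noteq> \<pi> (l + 1)"
      using enumerations_eq_iff[OF \<pi>, of l "l + 1"] l by simp
    consider "j = l" | "j = l + 1" | "j \<noteq> l" "j \<noteq> l + 1"
      by blast
    then show ?thesis
    proof cases
      case 1
      then show ?thesis
        using ne unfolding j(3)[symmetric] 1 by (simp add: axis_def)
    next
      case 2
      then show ?thesis
        using ne dl1 unfolding j(3)[symmetric] 2 by (simp add: axis_def)
    next
      case 3
      then have "i \<noteq> \<pi> l" "i \<noteq> \<pi> (l + 1)"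
        using enumerations_eq_iff[OF \<pi>, of j l] enumerations_eq_iff[OF \<pi>, of j "l + 1"] j l
        by auto
      moreover have "d $ i = 0"
        using indic_prefix_diff[OF \<pi> j(1,2), of d] d[of j] d[of "j - 1"] 3 j by simp
      ultimately show ?thesis
        by (simp add: axis_def)
    qed
  qed
  then show "d = (d $ \<pi> l) *\<^sub>R (axis (\<pi> l) 1 - axis (\<pi> (l + 1)) 1)"
    by (subst vec_eq_iff) blast
  show "d $ \<pi> l = indic (\<pi> ` {1..l}) \<bullet> d"
    by (rule dl)
qed

text \<open>Converse of \<open>gp_family_greedy\<close>. Enumerations adjacent across wall
  \<open>l\<close> share all prefixes of length other than \<open>l\<close>, so both points maximize
  those indicators and their difference has the edge direction. Greediness for the l-th prefix gives
  the sign.\<close>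

lemma gp_familyI_greedy:
  fixes v :: "(nat \<Rightarrow> 'n::finite) \<Rightarrow> real ^ 'n"
  assumes greedy: "\<And>\<pi> \<rho> c. \<pi> \<in> enumerations \<Longrightarrow> \<rho> \<in> enumerations \<Longrightarrow> sorts c \<pi> \<Longrightarrow>
      c \<bullet> v \<rho> \<le> c \<bullet> v \<pi>"
  shows "gp_family v"
proof -
  have "v \<pi> - v (swap_at \<pi> l) = slope v \<pi> l *\<^sub>R (axis (\<pi> l) 1 - axis (\<pi> (l + 1)) 1) \<and>
    0 \<le> slope v \<pi> l" if \<pi>: "\<pi> \<in> enumerations" and l: "1 \<le> l" "l < CARD('n)" for \<pi> l
  proof -
    let ?d = "v \<pi> - v (swap_at \<pi> l)"
    note E = swap_at_enumerations[OF \<pi> l]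
    have "indic (\<pi> ` {1..j}) \<bullet> ?d = 0" if "j \<le> CARD('n)" "j \<noteq> l" for j
      using greedy[OF \<pi> E sorts_indic_prefix[OF \<pi> that(1)]]
        greedy[OF E \<pi> sorts_indic_prefix[OF E that(1)]] swap_at_image[OF that(2) l(1), of \<pi>]
      by (simp add: inner_diff_right)
    note d = edge_of_prefixes[OF \<pi> l this]
    have "0 \<le> indic (\<pi> ` {1..l}) \<bullet> ?d"
      using greedy[OF \<pi> E sorts_indic_prefix[OF \<pi>, of l]] l by (simp add: inner_diff_right)
    then have "0 \<le> ?d $ \<pi> l"
      using d(2) by linarith
    then show ?thesis
      using d(1) unfolding slope_def by blast
  qed
  then show ?thesis
    by (auto simp: gp_family_def edge_family_def walls_def)
qed

lemma edge_family_slope_zero: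
  fixes v :: "(nat \<Rightarrow> 'n::finite) \<Rightarrow> real ^ 'n"
  assumes v: "edge_family v" and z: "\<And>\<pi> l. (\<pi>, l) \<in> walls \<Longrightarrow> slope v \<pi> l = 0"
    and E: "\<pi> \<in> enumerations" "\<rho> \<in> enumerations"
  shows "v \<pi> = v \<rho>"
proof (rule sorts_inner_eq_imp_eq[OF E(1)])
  fix c assume c: "sorts c \<pi>"
  \<comment> \<open>With all slopes zero both \<open>v\<close> and its negative are families, and
    the greedy inequality holds in both directions.\<close>
  have gp: "gp_family (\<lambda>\<pi>. a *\<^sub>R v \<pi>)" for a
    unfolding gp_family_def slope_linear using edge_family_linear(3)[OF v] z by auto
  show "c \<bullet> v \<pi> = c \<bullet> v \<rho>"
    using gp_family_greedy[OF gp[of 1] E c] gp_family_greedy[OF gp[of "-1"] E c] by simp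
qed

subsection \<open>Polytopes spanned by families\<close>

lemma gp_hull_vertex: "\<pi> \<in> enumerations \<Longrightarrow> v \<pi> \<in> gp_hull v"
  by (simp add: gp_hull_def hull_inc)

lemma gp_hull_support:
  assumes "gp_family v" "\<pi> \<in> enumerations" "sorts c \<pi>" "p \<in> gp_hull v"
  shows "c \<bullet> p \<le> c \<bullet> v \<pi>"
proof -
  have "gp_hull v \<subseteq> {p. c \<bullet> p \<le> c \<bullet> v \<pi>}"
    unfolding gp_hull_def
    by (rule hull_minimal) (use gp_family_greedy assms in \<open>auto simp: convex_halfspace_le\<close>)
  then show ?thesis
    using assms by blast
qed

lemma polytope_gp_hull: "polytope (gp_hull v)"
  using finite_enumerations by (auto simp: polytope_def gp_hull_def)

lemma gp_hull_cong: "(\<And>\<pi>. \<pi> \<in> enumerations \<Longrightarrow> v \<pi> = w \<pi>) \<Longrightarrow> gp_hull v = gp_hull w"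
  unfolding gp_hull_def by (metis image_cong)

lemma gp_hull_const: "gp_hull (\<lambda>\<pi>. t) = {t}"
  by (simp add: gp_hull_def image_constant_conv enumerations_nonempty)

lemma gp_hull_scale: "gp_hull (\<lambda>\<pi>. c *\<^sub>R v \<pi>) = (*\<^sub>R) c ` gp_hull v"
  by (simp add: gp_hull_def convex_hull_scaling[symmetric] image_image)

text \<open>A functional sorted by \<open>\<pi>\<close> attains its maximum over both summands at
  the same index \<open>\<pi>\<close>; separation turns this into the nontrivial inclusion.\<close>

lemma gp_hull_add:
  assumes v: "gp_family v" and w: "gp_family w"
  shows "gp_hull (\<lambda>\<pi>. v \<pi> + w \<pi>) = gp_hull v + gp_hull w"
proof
  show "gp_hull (\<lambda>\<pi>. v \<pi> + w \<pi>) \<subseteq> gp_hull v + gp_hull w"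
    unfolding gp_hull_def
    by (rule hull_minimal) (auto intro!: set_plus_intro hull_inc convex_set_plus)
  show "gp_hull v + gp_hull w \<subseteq> gp_hull (\<lambda>\<pi>. v \<pi> + w \<pi>)"
  proof
    fix z assume "z \<in> gp_hull v + gp_hull w"
    then obtain p q where pq: "p \<in> gp_hull v" "q \<in> gp_hull w" "z = p + q"
      by (rule set_plus_elim)
    show "z \<in> gp_hull (\<lambda>\<pi>. v \<pi> + w \<pi>)"
    proof (rule ccontr)
      assume "z \<notin> gp_hull (\<lambda>\<pi>. v \<pi> + w \<pi>)"
      then obtain c b where c: "c \<bullet> z < b" "\<And>u. u \<in> gp_hull (\<lambda>\<pi>. v \<pi> + w \<pi>) \<Longrightarrow> b < c \<bullet> u"
        using separating_hyperplane_closed_point[of "gp_hull (\<lambda>\<pi>. v \<pi> + w \<pi>)" z]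
          polytope_gp_hull polytope_imp_closed polytope_imp_convex by blast
      \<comment> \<open>The separated hull lies on the side where \<open>c\<close> is larger, so it
        is \<open>- c\<close> that has to be maximized.\<close>
      obtain \<pi> where \<pi>: "\<pi> \<in> enumerations" "sorts (- c) \<pi>"
        using exists_sorting by blast
      have "(- c) \<bullet> z \<le> (- c) \<bullet> (v \<pi> + w \<pi>)"
        using gp_hull_support[OF v \<pi> pq(1)] gp_hull_support[OF w \<pi> pq(2)] pq(3)
        by (simp add: inner_add_right)
      moreover have "b < c \<bullet> (v \<pi> + w \<pi>)"
        by (rule c(2)) (rule gp_hull_vertex[OF \<pi>(1)])
      ultimately show False
        using c(1) by simp
    qed
  qed
qed

lemma generalized_permutohedron_gp_hull: "gp_family v \<Longrightarrow> generalized_permutohedron (gp_hull v)"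
  unfolding generalized_permutohedron_iff by blast

lemma generalized_permutohedron_add:
  "generalized_permutohedron P \<Longrightarrow> generalized_permutohedron Q \<Longrightarrow> generalized_permutohedron (P + Q)"
  by (metis generalized_permutohedron_iff gp_family_add gp_hull_add)

lemma generalized_permutohedron_sum_list:
  "(\<And>Q. Q \<in> set Qs \<Longrightarrow> generalized_permutohedron Q) \<Longrightarrow> generalized_permutohedron (sum_list Qs)"
proof (induction Qs)
  case Nil
  have "{0 :: real ^ 'a} = gp_hull (\<lambda>\<pi>. 0)"
    by (rule gp_hull_const[symmetric])
  then have "generalized_permutohedron {0 :: real ^ 'a}"
    using generalized_permutohedron_gp_hull[OF gp_family_const] by simp
  then show ?case
    by simp
qed (simp add: generalized_permutohedron_add)

text \<open>No property of the complementary summand \<open>R\<close> is needed: for each \<open>\<pi>\<close> the point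
  \<open>c v\<^sub>\<pi>\<close> splits as \<open>w\<^sub>\<pi> + r\<^sub>\<pi>\<close>, and the \<open>r\<^sub>\<pi>\<close> inherit the greedy property.\<close>
lemma summand_family:
  fixes v w :: "(nat \<Rightarrow> 'n::finite) \<Rightarrow> real ^ 'n"
  assumes v: "gp_family v" and w: "gp_family w" and c: "0 < c"
    and eq: "(*\<^sub>R) c ` gp_hull v = gp_hull w + R"
  shows "gp_family (\<lambda>\<pi>. c *\<^sub>R v \<pi> - w \<pi>)"
proof -
  have cv: "gp_family (\<lambda>\<pi>. c *\<^sub>R v \<pi>)"
    by (rule gp_family_scale[OF v]) (use c in simp)
  have eq': "gp_hull (\<lambda>\<pi>. c *\<^sub>R v \<pi>) = gp_hull w + R"
    using eq by (simp add: gp_hull_scale)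
  have R: "c *\<^sub>R v \<pi> - w \<pi> \<in> R" if \<pi>: "\<pi> \<in> enumerations" for \<pi>
  proof -
    have "c *\<^sub>R v \<pi> \<in> gp_hull w + R"
      using gp_hull_vertex[OF \<pi>, of "\<lambda>\<pi>. c *\<^sub>R v \<pi>"] by (simp only: eq')
    then obtain p r where pr: "p \<in> gp_hull w" "r \<in> R" "c *\<^sub>R v \<pi> = p + r"
      by (rule set_plus_elim)
    have "w \<pi> + r \<in> gp_hull (\<lambda>\<pi>. c *\<^sub>R v \<pi>)"
      unfolding eq' by (rule set_plus_intro[OF gp_hull_vertex[OF \<pi>] pr(2)])
    \<comment> \<open>Both \<open>p + r\<close> and \<open>w \<pi> + r\<close> lie in the scaled
      hull, where \<open>p + r\<close> is maximal for \<open>a\<close>. Hence \<open>p\<close> is as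
      good as the maximizer \<open>w \<pi>\<close>.\<close>
    then have "a \<bullet> w \<pi> = a \<bullet> p" if "sorts a \<pi>" for a
      using gp_hull_support[OF cv \<pi> that] gp_hull_support[OF w \<pi> that pr(1)] pr(3)
      by (fastforce simp: inner_add_right)
    then have "w \<pi> = p"
      using sorts_inner_eq_imp_eq[OF \<pi>] by blast
    then show ?thesis
      using pr by simp
  qed
  show ?thesis
  proof (rule gp_familyI_greedy)
    fix \<pi> \<rho> :: "nat \<Rightarrow> 'n" and a
    assume \<pi>: "\<pi> \<in> enumerations" "\<rho> \<in> enumerations" "sorts a \<pi>"
    \<comment> \<open>Only the complementary component is taken at \<open>\<rho>\<close>; comparing
      this point with \<open>c *\<^sub>R v \<pi>\<close> cancels \<open>w \<pi>\<close>.\<close>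
    have "w \<pi> + (c *\<^sub>R v \<rho> - w \<rho>) \<in> gp_hull (\<lambda>\<pi>. c *\<^sub>R v \<pi>)"
      unfolding eq' by (rule set_plus_intro[OF gp_hull_vertex[OF \<pi>(1)] R[OF \<pi>(2)]])
    from gp_hull_support[OF cv \<pi>(1,3) this]
    show "a \<bullet> (c *\<^sub>R v \<rho> - w \<rho>) \<le> a \<bullet> (c *\<^sub>R v \<pi> - w \<pi>)"
      by (simp add: inner_add_right inner_diff_right)
  qed
qed

subsection \<open>Summands and flat walls\<close>

lemma finite_dominated:
  fixes f g :: "'a \<Rightarrow> real"
  assumes "finite A" "\<And>a. a \<in> A \<Longrightarrow> 0 \<le> f a" "\<And>a. a \<in> A \<Longrightarrow> f a = 0 \<Longrightarrow> g a = 0"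
  obtains M where "0 < M" "\<And>a. a \<in> A \<Longrightarrow> \<bar>g a\<bar> \<le> M * f a"
proof
  \<comment> \<open>Each ratio is bounded by the sum of all ratios, terms with
    \<open>f a = 0\<close> vanish because division by zero yields 0, and the summand 1 makes the
    bound positive.\<close>
  let ?M = "1 + (\<Sum>a\<in>A. \<bar>g a\<bar> / f a)"
  have nn: "0 \<le> \<bar>g a\<bar> / f a" if "a \<in> A" for a
    using assms(2)[OF that] by simp
  then have "0 \<le> (\<Sum>a\<in>A. \<bar>g a\<bar> / f a)"
    by (rule sum_nonneg)
  then show "0 < ?M"
    by simp
  show "\<bar>g a\<bar> \<le> ?M * f a" if "a \<in> A" for a
  proof (cases "f a = 0")
    case False
    then have "0 < f a"
      using assms(2)[OF that] by simp
    moreover have "\<bar>g a\<bar> / f a \<le> (\<Sum>a\<in>A. \<bar>g a\<bar> / f a)"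
      using member_le_sum[OF that, of "\<lambda>a. \<bar>g a\<bar> / f a"] nn assms(1) by auto
    then have "\<bar>g a\<bar> / f a \<le> ?M"
      by simp
    ultimately show ?thesis
      by (simp add: divide_le_eq)
  qed (simp add: assms(3) that)
qed

lemma flat_subset_dominated:
  assumes v: "gp_family v" and sub: "flat v \<subseteq> flat w"
  obtains M where "0 < M" "\<And>\<pi> l. (\<pi>, l) \<in> walls \<Longrightarrow> \<bar>slope w \<pi> l\<bar> \<le> M * slope v \<pi> l"
proof -
  obtain M where "0 < M" "\<And>a. a \<in> walls \<Longrightarrow> \<bar>case_prod (slope w) a\<bar> \<le> M * case_prod (slope v) a"
  proof (rule finite_dominated[OF finite_walls, of "case_prod (slope v)" "case_prod (slope w)"])
    show "case_prod (slope w) a = 0" if "a \<in> walls" "case_prod (slope v) a = 0" for a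
      using that sub by (cases a) (auto simp: flat_def)
  qed (use gp_family_slope[OF v] in auto)
  then show ?thesis
    by (intro that) fastforce+
qed

text \<open>If \<open>c v - w\<close> is a family, then a zero slope of \<open>v\<close> squeezes
  the slope of \<open>w\<close> to zero. Conversely \<open>M v - w\<close> is a family once
  \<open>M\<close> dominates the finitely many slope ratios, and it spans the complementary
  summand.\<close>

lemma minkowski_summand_gp_hull_iff:
  assumes v: "gp_family v" and w: "gp_family w"
  shows "minkowski_summand (gp_hull w) (gp_hull v) \<longleftrightarrow> flat v \<subseteq> flat w"
proof
  assume "minkowski_summand (gp_hull w) (gp_hull v)"
  then obtain c R where c: "0 < c" "(*\<^sub>R) c ` gp_hull v = gp_hull w + R"
    unfolding minkowski_summand_def by blast
  have u: "gp_family (\<lambda>\<pi>. c *\<^sub>R v \<pi> - w \<pi>)"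
    by (rule summand_family[OF v w c])
  have "slope w \<pi> l = 0" if "(\<pi>, l) \<in> walls" "slope v \<pi> l = 0" for \<pi> l
    using gp_family_slope[OF u that(1)] gp_family_slope[OF w that(1)] that(2)
    by (simp add: slope_linear)
  then show "flat v \<subseteq> flat w"
    by (auto simp: flat_def)
next
  assume "flat v \<subseteq> flat w"
  then obtain M where M: "0 < M" "\<And>\<pi> l. (\<pi>, l) \<in> walls \<Longrightarrow> \<bar>slope w \<pi> l\<bar> \<le> M * slope v \<pi> l"
    using flat_subset_dominated[OF v] by blast
  let ?u = "\<lambda>\<pi>. M *\<^sub>R v \<pi> - w \<pi>"
  have "gp_family ?u"
    unfolding gp_family_def slope_linear
    using M(2) v w by (fastforce intro: edge_family_linear simp: gp_family_def)
  then have "gp_hull (\<lambda>\<pi>. w \<pi> + ?u \<pi>) = gp_hull w + gp_hull ?u"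
    by (rule gp_hull_add[OF w])
  then have "(*\<^sub>R) M ` gp_hull v = gp_hull w + gp_hull ?u"
    by (simp add: gp_hull_scale)
  then show "minkowski_summand (gp_hull w) (gp_hull v)"
    unfolding minkowski_summand_def using polytope_gp_hull M(1) by blast
qed

lemma summand_equivalent_gp_hull_iff:
  assumes "gp_family v" "gp_family w"
  shows "summand_equivalent (gp_hull w) (gp_hull v) \<longleftrightarrow> flat w = flat v"
  by (auto simp: summand_equivalent_def minkowski_summand_gp_hull_iff assms)

lemma flat_scale: "c \<noteq> 0 \<Longrightarrow> flat (\<lambda>\<pi>. c *\<^sub>R v \<pi>) = flat v"
  by (simp add: flat_def slope_linear)

text \<open>A ratio test: \<open>\<alpha>\<close> is the least quotient of slopes over the walls not
  flat for \<open>w\<close>. A wall attaining it becomes flat after the subtraction, but is not flat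
  for \<open>v\<close>, because \<open>flat v\<close> lies in \<open>flat w\<close>.\<close>

lemma maximal_subtraction:
  assumes v: "gp_family v" and w: "gp_family w" and sub: "flat v \<subseteq> flat w" and ne: "flat w \<noteq> walls"
  obtains \<alpha> where "0 < \<alpha>" "gp_family (\<lambda>\<pi>. v \<pi> - \<alpha> *\<^sub>R w \<pi>)"
    "flat v \<subset> flat (\<lambda>\<pi>. v \<pi> - \<alpha> *\<^sub>R w \<pi>)"
proof -
  let ?r = "\<lambda>(\<pi>, l). slope v \<pi> l / slope w \<pi> l"
  have flat_sub: "flat w \<subseteq> walls"
    by (auto simp: flat_def)
  have A: "finite (walls - flat w)" "walls - flat w \<noteq> {}"
    using finite_walls ne flat_sub by auto
  define \<alpha> where "\<alpha> = Min (?r ` (walls - flat w))"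
  have "\<alpha> \<in> ?r ` (walls - flat w)"
    unfolding \<alpha>_def using A by (intro Min_in) auto
  then obtain \<pi>0 l0 where p0: "(\<pi>0, l0) \<in> walls - flat w" "\<alpha> = slope v \<pi>0 l0 / slope w \<pi>0 l0"
    by auto
  have pos: "0 < slope w \<pi> l" "0 < slope v \<pi> l" if "(\<pi>, l) \<in> walls - flat w" for \<pi> l
  proof -
    have "slope w \<pi> l \<noteq> 0" "slope v \<pi> l \<noteq> 0"
      using that sub by (auto simp: flat_def)
    then show "0 < slope w \<pi> l" "0 < slope v \<pi> l"
      using gp_family_slope[OF w, of \<pi> l] gp_family_slope[OF v, of \<pi> l] that by auto
  qed
  have le: "\<alpha> * slope w \<pi> l \<le> slope v \<pi> l" if "(\<pi>, l) \<in> walls" for \<pi> l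
  proof (cases "(\<pi>, l) \<in> flat w")
    case True
    then show ?thesis
      using gp_family_slope[OF v that] by (simp add: flat_def)
  next
    case False
    then have "?r (\<pi>, l) \<in> ?r ` (walls - flat w)"
      using that by (intro imageI) simp
    then have "\<alpha> \<le> slope v \<pi> l / slope w \<pi> l"
      unfolding \<alpha>_def using A(1) by simp
    then show ?thesis
      using pos(1)[of \<pi> l] that False by (simp add: pos_le_divide_eq)
  qed
  let ?u = "\<lambda>\<pi>. v \<pi> - \<alpha> *\<^sub>R w \<pi>"
  have "gp_family ?u"
    unfolding gp_family_def slope_linear
    using le v w by (fastforce intro: edge_family_linear simp: gp_family_def)
  moreover have "0 < \<alpha>"
    using pos[OF p0(1)] p0(2) by simp
  moreover have "flat v \<subseteq> flat ?u"
    using sub by (auto simp: flat_def slope_linear)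
  moreover have "(\<pi>0, l0) \<in> flat ?u" "(\<pi>0, l0) \<notin> flat v"
    using pos[OF p0(1)] p0 by (auto simp: flat_def slope_linear)
  ultimately show ?thesis
    using that by blast
qed

subsection \<open>Indecomposability as extremality\<close>

text \<open>The families \<open>w\<close> considered form the smallest face of the cone containing
  \<open>v\<close>; modulo translations it has to be spanned by \<open>v\<close>. Constant families
  qualify, in accordance with single points being indecomposable.\<close>

definition extremal :: "((nat \<Rightarrow> 'n) \<Rightarrow> real ^ 'n::finite) \<Rightarrow> bool" where
  "extremal v \<longleftrightarrow> (\<forall>w. gp_family w \<and> flat v \<subseteq> flat w \<longrightarrow>
     (\<exists>c t. \<forall>\<pi> \<in> enumerations. w \<pi> = c *\<^sub>R v \<pi> + t))"

lemma slope_cong: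
  assumes "(\<pi>, l) \<in> walls" "\<And>\<pi>. \<pi> \<in> enumerations \<Longrightarrow> v \<pi> = w \<pi>"
  shows "slope v \<pi> l = slope w \<pi> l"
  using assms swap_at_enumerations[of \<pi> l] by (auto simp: slope_def walls_def)

lemma flat_walls_imp_const:
  assumes "gp_family v" "flat v = walls"
  obtains t where "\<And>\<pi>. \<pi> \<in> enumerations \<Longrightarrow> v \<pi> = t"
proof -
  obtain \<rho> where \<rho>: "(\<rho> :: nat \<Rightarrow> 'a) \<in> enumerations"
    using enumerations_nonempty by blast
  have "slope v \<pi> l = 0" if "(\<pi>, l) \<in> walls" for \<pi> l
    using that assms(2) by (auto simp: flat_def)
  then show ?thesis
    using edge_family_slope_zero[OF gp_family_edge[OF assms(1)] _ _ \<rho>] that[of "v \<rho>"] by blast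
qed

lemma sum_list_singletons:
  fixes Qs :: "'a::comm_monoid_add set list"
  shows "(\<And>Q. Q \<in> set Qs \<Longrightarrow> \<exists>t. Q = {t}) \<Longrightarrow> \<exists>t. sum_list Qs = {t}"
proof (induction Qs)
  case (Cons Q Qs)
  then obtain s t where "Q = {s}" "sum_list Qs = {t}"
    by (metis list.set_intros)
  then show ?case
    by (auto simp: set_plus_def)
qed simp

text \<open>The remaining summands add up to a generalized permutohedron, in particular to a
  polytope, and so exhibit \<open>gp_hull w\<close> as a Minkowski summand.\<close>

lemma flat_subset_of_decomposition:
  assumes v: "gp_family v" and c: "0 < c" and eq: "(*\<^sub>R) c ` gp_hull v = sum_list Qs"
    and gp: "\<And>Q. Q \<in> set Qs \<Longrightarrow> generalized_permutohedron Q"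
    and w: "gp_family w" "gp_hull w \<in> set Qs"
  shows "flat v \<subseteq> flat w"
proof -
  define R where "R = sum_list (remove1 (gp_hull w) Qs)"
  have "generalized_permutohedron R"
    unfolding R_def using gp by (intro generalized_permutohedron_sum_list) (meson notin_set_remove1)
  then have "polytope R"
    unfolding generalized_permutohedron_iff by (auto simp: polytope_gp_hull)
  moreover have "(*\<^sub>R) c ` gp_hull v = gp_hull w + R"
    unfolding eq R_def using sum_list_map_remove1[OF w(2), of "\<lambda>Q. Q"] by simp
  ultimately have "minkowski_summand (gp_hull w) (gp_hull v)"
    unfolding minkowski_summand_def using c polytope_gp_hull by blast
  then show ?thesis
    using minkowski_summand_gp_hull_iff[OF v w(1)] by simp
qed

text \<open>For extremal \<open>v\<close>, every inequivalent summand is a point, so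
  \<open>gp_hull v\<close> would itself be a point and equivalent to its summands. If
  \<open>v\<close> is indecomposable, two maximal subtractions would split it unless the first
  leaves only a translation.\<close>

lemma indecomposable_gp_hull_iff:
  fixes v :: "(nat \<Rightarrow> 'n::finite) \<Rightarrow> real ^ 'n"
  assumes v: "gp_family v"
  shows "indecomposable_gp (gp_hull v) \<longleftrightarrow> extremal v"
proof
  assume ex: "extremal v"
  have "\<not> has_nontrivial_decomposition (gp_hull v)"
  proof
    assume "has_nontrivial_decomposition (gp_hull v)"
    then obtain c Qs where c: "0 < c" "Qs \<noteq> []" "(*\<^sub>R) c ` gp_hull v = sum_list Qs"
      and Qs: "\<And>Q. Q \<in> set Qs \<Longrightarrow> generalized_permutohedron Q"
        "\<And>Q. Q \<in> set Qs \<Longrightarrow> \<not> summand_equivalent Q (gp_hull v)"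
      unfolding has_nontrivial_decomposition_def by blast
    have const: "\<exists>w. gp_family w \<and> Q = gp_hull w \<and> flat w = walls" if Q: "Q \<in> set Qs" for Q
    proof -
      obtain w where w: "gp_family w" "Q = gp_hull w"
        using Qs(1)[OF Q] generalized_permutohedron_iff by blast
      have sub: "flat v \<subseteq> flat w"
        using flat_subset_of_decomposition[OF v c(1,3) Qs(1) w(1)] Q w(2) by blast
      then obtain a t where at: "\<And>\<pi>. \<pi> \<in> enumerations \<Longrightarrow> w \<pi> = a *\<^sub>R v \<pi> + t"
        using ex w unfolding extremal_def by blast
      have sl: "slope w \<pi> l = a * slope v \<pi> l" if "(\<pi>, l) \<in> walls" for \<pi> l
        using slope_cong[OF that at] by (simp add: slope_linear)
      have "flat w \<noteq> flat v"
        using Qs(2)[OF Q] summand_equivalent_gp_hull_iff[OF v w(1)] w(2) by simp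
      \<comment> \<open>A nonzero factor would give \<open>w\<close> and \<open>v\<close> the same
        zero slopes.\<close>
      then have "a = 0"
        using sl by (auto simp: flat_def)
      then have "flat w = walls"
        using sl by (auto simp: flat_def)
      then show ?thesis
        using w by blast
    qed
    have "\<exists>t. Q = {t}" if Q: "Q \<in> set Qs" for Q
    proof -
      obtain w where w: "gp_family w" "Q = gp_hull w" "flat w = walls"
        using const[OF Q] by blast
      obtain t where "\<And>\<pi>. \<pi> \<in> enumerations \<Longrightarrow> w \<pi> = t"
        using flat_walls_imp_const[OF w(1,3)] by blast
      then have "gp_hull w = gp_hull (\<lambda>\<pi>. t)"
        by (rule gp_hull_cong)
      then show ?thesis
        using w(2) gp_hull_const by blast
    qed
    then obtain s where s: "(*\<^sub>R) c ` gp_hull v = {s}"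
      using sum_list_singletons[of Qs] c(3) by auto
    have "slope v \<pi> l = 0" if "(\<pi>, l) \<in> walls" for \<pi> l
    proof -
      have "\<pi> \<in> enumerations" "swap_at \<pi> l \<in> enumerations"
        using that swap_at_enumerations by (auto simp: walls_def)
      then have "c *\<^sub>R v \<pi> \<in> {s}" "c *\<^sub>R v (swap_at \<pi> l) \<in> {s}"
        using s gp_hull_vertex by blast+
      then have "c *\<^sub>R v \<pi> = c *\<^sub>R v (swap_at \<pi> l)"
        by simp
      then have "v \<pi> = v (swap_at \<pi> l)"
        using c(1) by (simp only: scaleR_cancel_left) simp
      then show ?thesis
        by (simp add: slope_def)
    qed
    then have "flat v = walls"
      by (auto simp: flat_def)
    \<comment> \<open>All walls are flat for \<open>v\<close> and for each summand, so any one
      summand, existing since \<open>Qs\<close> is nonempty, is equivalent to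
      \<open>gp_hull v\<close>.\<close>
    moreover obtain Q where "Q \<in> set Qs"
      using c(2) by (meson list.set_sel(1))
    ultimately show False
      using const[of Q] Qs(2)[of Q] summand_equivalent_gp_hull_iff[OF v] by metis
  qed
  then show "indecomposable_gp (gp_hull v)"
    using generalized_permutohedron_gp_hull[OF v] by (simp add: indecomposable_gp_def)
next
  assume ind: "indecomposable_gp (gp_hull v)"
  show "extremal v"
    unfolding extremal_def
  proof (intro allI impI)
    fix w assume w: "gp_family w \<and> flat v \<subseteq> flat w"
    show "\<exists>c t. \<forall>\<pi>\<in>enumerations. w \<pi> = c *\<^sub>R v \<pi> + t"
    proof (cases "flat w = walls")
      case True
      then obtain t where "\<And>\<pi>. \<pi> \<in> enumerations \<Longrightarrow> w \<pi> = t"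
        using flat_walls_imp_const w by blast
      then show ?thesis
        by (intro exI[of _ 0] exI[of _ t]) simp
    next
      case False
      then obtain \<alpha> where \<alpha>: "0 < \<alpha>" "gp_family (\<lambda>\<pi>. v \<pi> - \<alpha> *\<^sub>R w \<pi>)"
        "flat v \<subset> flat (\<lambda>\<pi>. v \<pi> - \<alpha> *\<^sub>R w \<pi>)"
        using maximal_subtraction[OF v] w by blast
      let ?u = "\<lambda>\<pi>. v \<pi> - \<alpha> *\<^sub>R w \<pi>"
      have "flat ?u = walls"
      proof (rule ccontr)
        assume "flat ?u \<noteq> walls"
        \<comment> \<open>The remainder \<open>?u\<close> already has more flat walls than
          \<open>v\<close>. Subtracting it maximally from \<open>v\<close> makes the other part
          inequivalent as well.\<close>
        then obtain \<beta> where \<beta>: "0 < \<beta>" "gp_family (\<lambda>\<pi>. v \<pi> - \<beta> *\<^sub>R ?u \<pi>)"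
          "flat v \<subset> flat (\<lambda>\<pi>. v \<pi> - \<beta> *\<^sub>R ?u \<pi>)"
          using maximal_subtraction[OF v \<alpha>(2)] \<alpha>(3) by blast
        let ?a = "\<lambda>\<pi>. \<beta> *\<^sub>R ?u \<pi>" and ?b = "\<lambda>\<pi>. v \<pi> - \<beta> *\<^sub>R ?u \<pi>"
        have a: "gp_family ?a"
          by (rule gp_family_scale[OF \<alpha>(2)]) (use \<beta>(1) in simp)
        have "flat ?a = flat ?u"
          by (rule flat_scale) (use \<beta>(1) in simp)
        then have ne: "\<not> summand_equivalent (gp_hull ?a) (gp_hull v)"
          "\<not> summand_equivalent (gp_hull ?b) (gp_hull v)"
          using summand_equivalent_gp_hull_iff[OF v a] summand_equivalent_gp_hull_iff[OF v \<beta>(2)]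
            \<alpha>(3) \<beta>(3) by auto
        have "gp_hull (\<lambda>\<pi>. ?a \<pi> + ?b \<pi>) = gp_hull ?a + gp_hull ?b"
          by (rule gp_hull_add[OF a \<beta>(2)])
        then have "(*\<^sub>R) 1 ` gp_hull v = sum_list [gp_hull ?a, gp_hull ?b]"
          by simp
        moreover have "\<forall>Q \<in> set [gp_hull ?a, gp_hull ?b].
            generalized_permutohedron Q \<and> \<not> summand_equivalent Q (gp_hull v)"
          using ne generalized_permutohedron_gp_hull[OF a] generalized_permutohedron_gp_hull[OF \<beta>(2)]
          by simp
        ultimately have "has_nontrivial_decomposition (gp_hull v)"
          unfolding has_nontrivial_decomposition_def
          by (metis (no_types, lifting) list.distinct(1) zero_less_one)
        then show False
          using ind by (simp add: indecomposable_gp_def)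
      qed
      then obtain t where t: "\<And>\<pi>. \<pi> \<in> enumerations \<Longrightarrow> v \<pi> - \<alpha> *\<^sub>R w \<pi> = t"
        using flat_walls_imp_const[OF \<alpha>(2)] by blast
      have "w \<pi> = (1 / \<alpha>) *\<^sub>R v \<pi> + (- (1 / \<alpha>)) *\<^sub>R t" if "\<pi> \<in> enumerations" for \<pi>
        using \<alpha>(1) unfolding t[OF that, symmetric] by (simp add: algebra_simps)
      then show ?thesis
        by blast
    qed
  qed
qed

section \<open>Decomposition into indecomposable summands\<close>

lemma image_scaleR_plus:
  "(*\<^sub>R) c ` (A + B) = (*\<^sub>R) c ` A + (*\<^sub>R) c ` (B :: 'a::real_vector set)"
proof -
  have "(*\<^sub>R) c ` (A + B) = {c *\<^sub>R (a + b) | a b. a \<in> A \<and> b \<in> B}"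
    unfolding set_plus_def by blast
  also have "\<dots> = (*\<^sub>R) c ` A + (*\<^sub>R) c ` B"
    unfolding set_plus_def scaleR_add_right by blast
  finally show ?thesis .
qed

lemma image_scaleR_sum_list:
  "(*\<^sub>R) c ` sum_list Qs = sum_list (map ((`) ((*\<^sub>R) c)) (Qs :: 'a::real_vector set list))"
  by (induction Qs) (simp_all add: image_scaleR_plus)

lemma sum_list_concat_map:
  "sum_list (concat (map f xs)) = (\<Sum>x\<leftarrow>xs. sum_list (f x) :: 'a::monoid_add)"
  by (induction xs) simp_all

text \<open>Induction on the number of walls that are not flat: the summands of a nontrivial
  decomposition have strictly more flat walls. Scaling by \<open>1 / c\<close> undoes the factor and
  preserves the flat walls.\<close>

lemma gp_hull_sum_indecomposable:
  fixes v :: "(nat \<Rightarrow> 'n::finite) \<Rightarrow> real ^ 'n"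
  assumes "gp_family v"
  shows "\<exists>Rs. Rs \<noteq> [] \<and> (\<forall>R \<in> set Rs. indecomposable_gp R) \<and> gp_hull v = sum_list Rs"
  using assms
proof (induction "card (walls - flat v)" arbitrary: v rule: less_induct)
  case less
  show ?case
  proof (cases "indecomposable_gp (gp_hull v)")
    case True
    then show ?thesis
      by (intro exI[of _ "[gp_hull v]"]) simp
  next
    case False
    then obtain c Qs where c: "0 < c" "Qs \<noteq> []" "(*\<^sub>R) c ` gp_hull v = sum_list Qs"
      and Qs: "\<And>Q. Q \<in> set Qs \<Longrightarrow> generalized_permutohedron Q"
        "\<And>Q. Q \<in> set Qs \<Longrightarrow> \<not> summand_equivalent Q (gp_hull v)"
      using generalized_permutohedron_gp_hull[OF less.prems]
      unfolding indecomposable_gp_def has_nontrivial_decomposition_def by blast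
    have "\<exists>Rs. Rs \<noteq> [] \<and> (\<forall>R \<in> set Rs. indecomposable_gp R) \<and> (*\<^sub>R) (1 / c) ` Q = sum_list Rs"
      if Q: "Q \<in> set Qs" for Q
    proof -
      obtain w where w: "gp_family w" "Q = gp_hull w"
        using Qs(1)[OF Q] generalized_permutohedron_iff by blast
      have "flat v \<subseteq> flat w"
        using flat_subset_of_decomposition[OF less.prems c(1,3) Qs(1) w(1)] Q w(2) by blast
      moreover have "flat w \<noteq> flat v"
        using Qs(2)[OF Q] summand_equivalent_gp_hull_iff[OF less.prems w(1)] w(2) by simp
      moreover have "flat w \<subseteq> walls"
        by (auto simp: flat_def)
      ultimately have lt: "card (walls - flat w) < card (walls - flat v)"
        by (intro psubset_card_mono) (auto simp: finite_walls)
      let ?w = "\<lambda>\<pi>. (1 / c) *\<^sub>R w \<pi>"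
      have "gp_family ?w"
        using gp_family_scale[OF w(1), of "1 / c"] c(1) by simp
      moreover have "flat ?w = flat w"
        using c(1) by (intro flat_scale) simp
      ultimately have "\<exists>Rs. Rs \<noteq> [] \<and> (\<forall>R \<in> set Rs. indecomposable_gp R) \<and> gp_hull ?w = sum_list Rs"
        using less.hyps lt by simp
      then show ?thesis
        using gp_hull_scale[of "1 / c" w] w(2) by simp
    qed
    then obtain Rs where Rs: "\<And>Q. Q \<in> set Qs \<Longrightarrow> Rs Q \<noteq> []"
      "\<And>Q. Q \<in> set Qs \<Longrightarrow> \<forall>R \<in> set (Rs Q). indecomposable_gp R"
      "\<And>Q. Q \<in> set Qs \<Longrightarrow> (*\<^sub>R) (1 / c) ` Q = sum_list (Rs Q)"
      by metis
    have "gp_hull v = (*\<^sub>R) (1 / c) ` (*\<^sub>R) c ` gp_hull v"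
      using c(1) by (simp add: image_image)
    also have "\<dots> = sum_list (map ((`) ((*\<^sub>R) (1 / c))) Qs)"
      unfolding c(3) by (rule image_scaleR_sum_list)
    also have "\<dots> = sum_list (map (\<lambda>Q. sum_list (Rs Q)) Qs)"
      by (intro arg_cong[where f = sum_list] map_cong refl Rs(3))
    also have "\<dots> = sum_list (concat (map Rs Qs))"
      by (rule sum_list_concat_map[symmetric])
    finally have "gp_hull v = sum_list (concat (map Rs Qs))" .
    moreover have "concat (map Rs Qs) \<noteq> []"
      using Rs(1) c(2) by (cases Qs) auto
    moreover have "\<forall>R \<in> set (concat (map Rs Qs)). indecomposable_gp R"
      using Rs(2) by auto
    ultimately show ?thesis
      by blast
  qed
qed

subsection \<open>Standardized polytopes\<close>

lemma exists_enumeration_last: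
  fixes i :: "'n::finite"
  obtains \<pi> where "\<pi> \<in> enumerations" "\<pi> CARD('n) = i"
proof -
  obtain \<pi> where \<pi>: "\<pi> \<in> enumerations" "sorts (- axis i 1) \<pi>"
    using exists_sorting by blast
  obtain k where k: "1 \<le> k" "k \<le> CARD('n)" "\<pi> k = i"
    using enumerations_obtain[OF \<pi>(1)] by blast
  have "(- axis i 1 :: real ^ 'n) $ \<pi> CARD('n) \<le> (- axis i 1) $ \<pi> k"
    using \<pi>(2) k unfolding sorts_def by blast
  then have "\<pi> CARD('n) = i"
    using k by (auto simp: axis_def split: if_splits)
  then show ?thesis
    using that \<pi> by blast
qed

lemma sorts_minus_last:
  fixes \<pi> :: "nat \<Rightarrow> 'n::finite"
  assumes "\<pi> \<in> enumerations"
  shows "sorts (- axis (\<pi> CARD('n)) 1) \<pi>"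
  unfolding sorts_def
proof (intro allI impI)
  fix k l assume kl: "1 \<le> k \<and> k \<le> l \<and> l \<le> CARD('n)"
  have "l = CARD('n)" if "\<pi> k = \<pi> CARD('n)"
    using enumerations_eq_iff[OF assms, of k "CARD('n)"] that kl by simp
  then show "(- axis (\<pi> CARD('n)) 1 :: real ^ 'n) $ \<pi> l \<le> (- axis (\<pi> CARD('n)) 1) $ \<pi> k"
    by (auto simp: axis_def)
qed

lemma gp_hull_last_minimal:
  fixes \<pi> :: "nat \<Rightarrow> 'n::finite"
  assumes "gp_family v" "\<pi> \<in> enumerations" "p \<in> gp_hull v"
  shows "v \<pi> $ \<pi> CARD('n) \<le> p $ \<pi> CARD('n)"
  using gp_hull_support[OF assms(1,2) sorts_minus_last[OF assms(2)] assms(3)]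
  by (simp add: inner_axis inner_commute)

text \<open>The minimum of coordinate \<open>i\<close> over the hull is attained at
  \<open>v \<pi>\<close> for every \<open>\<pi>\<close> that ends in \<open>i\<close>, and
  standardization says that all these minima are 0.\<close>

lemma standardized_gp_hull_iff:
  fixes v :: "(nat \<Rightarrow> 'n::finite) \<Rightarrow> real ^ 'n"
  assumes v: "gp_family v"
  shows "standardized (gp_hull v) \<longleftrightarrow> (\<forall>\<pi> \<in> enumerations. v \<pi> $ \<pi> CARD('n) = 0)"
proof
  assume st: "standardized (gp_hull v)"
  show "\<forall>\<pi> \<in> enumerations. v \<pi> $ \<pi> CARD('n) = 0"
  proof
    fix \<pi> :: "nat \<Rightarrow> 'n" assume \<pi>: "\<pi> \<in> enumerations"
    obtain p where "p \<in> gp_hull v" "p $ \<pi> CARD('n) = 0"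
      using st unfolding standardized_def by blast
    then have "v \<pi> $ \<pi> CARD('n) \<le> 0"
      using gp_hull_last_minimal[OF v \<pi>] by metis
    moreover have "0 \<le> v \<pi> $ \<pi> CARD('n)"
      using st gp_hull_vertex[OF \<pi>] unfolding standardized_def by blast
    ultimately show "v \<pi> $ \<pi> CARD('n) = 0"
      by simp
  qed
next
  assume z: "\<forall>\<pi> \<in> enumerations. v \<pi> $ \<pi> CARD('n) = 0"
  have "0 \<le> p $ i" if "p \<in> gp_hull v" for p i
  proof -
    obtain \<pi> where "\<pi> \<in> enumerations" "\<pi> CARD('n) = i"
      using exists_enumeration_last by blast
    then show ?thesis
      using gp_hull_last_minimal[OF v _ that, of \<pi>] z by force
  qed
  moreover have "\<exists>p \<in> gp_hull v. p $ i = 0" for i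
  proof -
    obtain \<pi> where "\<pi> \<in> enumerations" "\<pi> CARD('n) = i"
      using exists_enumeration_last by blast
    then show ?thesis
      using gp_hull_vertex z by blast
  qed
  ultimately show "standardized (gp_hull v)"
    using polytope_gp_hull by (auto simp: standardized_def)
qed

text \<open>At an enumeration ending in \<open>i\<close>, coordinate \<open>i\<close> of the
  equation reads \<open>0 = c * 0 + t $ i\<close>.\<close>

lemma standardized_affine_imp_scalar:
  fixes v w :: "(nat \<Rightarrow> 'n::finite) \<Rightarrow> real ^ 'n"
  assumes "\<forall>\<pi> \<in> enumerations. v \<pi> $ \<pi> CARD('n) = 0" "\<forall>\<pi> \<in> enumerations. w \<pi> $ \<pi> CARD('n) = 0"
    and eq: "\<And>\<pi>. \<pi> \<in> enumerations \<Longrightarrow> w \<pi> = c *\<^sub>R v \<pi> + t"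
  shows "t = 0"
proof -
  have "t $ i = 0" for i
  proof -
    obtain \<pi> where "\<pi> \<in> enumerations" "\<pi> CARD('n) = i"
      using exists_enumeration_last by blast
    then show ?thesis
      using assms(1,2) eq[of \<pi>] by auto
  qed
  then show ?thesis
    by (simp add: vec_eq_iff)
qed

text \<open>If \<open>w = c v\<close> with \<open>c \<le> 0\<close>, then all entries vanish and \<open>c\<close> may be replaced by \<open>1\<close>.\<close>
lemma extremal_equivalent_scalar:
  fixes v w :: "(nat \<Rightarrow> 'n::finite) \<Rightarrow> real ^ 'n"
  assumes v: "gp_family v" "standardized (gp_hull v)" and w: "gp_family w" "standardized (gp_hull w)"
    and ex: "extremal v" and flat: "flat w = flat v"
  shows "\<exists>c>0. gp_hull w = (*\<^sub>R) c ` gp_hull v"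
proof -
  have zv: "\<forall>\<pi> \<in> enumerations. v \<pi> $ \<pi> CARD('n) = 0"
    using standardized_gp_hull_iff[OF v(1)] v(2) by simp
  have zw: "\<forall>\<pi> \<in> enumerations. w \<pi> $ \<pi> CARD('n) = 0"
    using standardized_gp_hull_iff[OF w(1)] w(2) by simp
  obtain c t where ct: "\<And>\<pi>. \<pi> \<in> enumerations \<Longrightarrow> w \<pi> = c *\<^sub>R v \<pi> + t"
    using ex w(1) flat unfolding extremal_def by blast
  then have c: "w \<pi> = c *\<^sub>R v \<pi>" if "\<pi> \<in> enumerations" for \<pi>
    using standardized_affine_imp_scalar[OF zv zw ct] that by simp
  show ?thesis
  proof (cases "0 < c")
    case True
    have "gp_hull w = gp_hull (\<lambda>\<pi>. c *\<^sub>R v \<pi>)"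
      by (rule gp_hull_cong) (rule c)
    then show ?thesis
      using True gp_hull_scale by blast
  next
    case False
    have sl: "slope w \<pi> l = c * slope v \<pi> l" if "(\<pi>, l) \<in> walls" for \<pi> l
      using slope_cong[OF that c] by (simp add: slope_linear)
    have "slope v \<pi> l = 0 \<and> slope w \<pi> l = 0" if pl: "(\<pi>, l) \<in> walls" for \<pi> l
    proof -
      \<comment> \<open>With \<open>c \<le> 0\<close> the slope of \<open>w\<close> is both
        nonnegative and nonpositive; equality of the flat sets then carries the zero over to
        \<open>v\<close>.\<close>
      have "slope w \<pi> l = 0"
        using sl[OF pl] False gp_family_slope[OF v(1) pl] gp_family_slope[OF w(1) pl]
        by (metis mult_nonneg_nonpos mult.commute not_le order_antisym)
      then show ?thesis
        using flat pl by (auto simp: flat_def)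
    qed
    then have "flat v = walls" "flat w = walls"
      by (auto simp: flat_def)
    then obtain s t where st: "\<And>\<pi>. \<pi> \<in> enumerations \<Longrightarrow> v \<pi> = s" "\<And>\<pi>. \<pi> \<in> enumerations \<Longrightarrow> w \<pi> = t"
      using flat_walls_imp_const v(1) w(1) by metis
    have "s = t"
    proof -
      have "w \<pi> = 1 *\<^sub>R v \<pi> + (t - s)" if "\<pi> \<in> enumerations" for \<pi>
        using st that by simp
      then show ?thesis
        using standardized_affine_imp_scalar[OF zv zw] by fastforce
    qed
    then have "gp_hull w = (*\<^sub>R) 1 ` gp_hull v"
      using gp_hull_cong[of w v] st by simp
    then show ?thesis
      using zero_less_one by blast
  qed
qed

section \<open>Equivalence classes of indecomposables and their finiteness\<close>

lemma standardized_equivalent_iff: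
  fixes P Q :: "(real ^ 'n::finite) set"
  assumes ind: "indecomposable_gp P" and st: "standardized P"
  shows "generalized_permutohedron Q \<and> standardized Q \<and> summand_equivalent Q P \<longleftrightarrow>
    (\<exists>c>0. Q = (*\<^sub>R) c ` P)"
proof -
  obtain v where v: "gp_family v" "P = gp_hull v"
    using ind generalized_permutohedron_iff unfolding indecomposable_gp_def by blast
  have ex: "extremal v"
    using indecomposable_gp_hull_iff[OF v(1)] ind v(2) by simp
  have zv: "\<forall>\<pi> \<in> enumerations. v \<pi> $ \<pi> CARD('n) = 0"
    using standardized_gp_hull_iff[OF v(1)] st v(2) by simp
  show ?thesis
  proof
    assume Q: "generalized_permutohedron Q \<and> standardized Q \<and> summand_equivalent Q P"
    then obtain w where w: "gp_family w" "Q = gp_hull w"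
      using generalized_permutohedron_iff by blast
    have "flat w = flat v"
      using summand_equivalent_gp_hull_iff[OF v(1) w(1)] Q v(2) w(2) by simp
    then show "\<exists>c>0. Q = (*\<^sub>R) c ` P"
      using extremal_equivalent_scalar[OF v(1) _ w(1) _ ex] st Q v(2) w(2) by blast
  next
    assume "\<exists>c>0. Q = (*\<^sub>R) c ` P"
    then obtain c where c: "0 < c" "Q = gp_hull (\<lambda>\<pi>. c *\<^sub>R v \<pi>)"
      using v(2) gp_hull_scale by blast
    have w: "gp_family (\<lambda>\<pi>. c *\<^sub>R v \<pi>)"
      using gp_family_scale[OF v(1)] c(1) by simp
    moreover have "standardized Q"
      unfolding c(2) standardized_gp_hull_iff[OF w] using zv by simp
    moreover have "summand_equivalent Q P"
      using summand_equivalent_gp_hull_iff[OF v(1) w] flat_scale[of c v] c v(2) by simp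
    ultimately show "generalized_permutohedron Q \<and> standardized Q \<and> summand_equivalent Q P"
      using generalized_permutohedron_gp_hull c(2) by blast
  qed
qed

text \<open>The set of flat walls, one of finitely many subsets of \<open>walls\<close>, determines
  a standardized extremal family up to scaling.\<close>

lemma finitely_many_indecomposable:
  "\<exists>F :: (real ^ 'n::finite) set set. finite F \<and>
     (\<forall>Q. indecomposable_gp Q \<and> standardized Q \<longrightarrow> (\<exists>R \<in> F. \<exists>c>0. Q = (*\<^sub>R) c ` R))"
proof -
  define good where "good v A \<longleftrightarrow> gp_family v \<and> extremal v \<and> standardized (gp_hull v) \<and> flat v = A"
    for v :: "(nat \<Rightarrow> 'n) \<Rightarrow> real ^ 'n" and A
  \<comment> \<open>One representative per set of walls; where no good family exists, the choice
    contributes an arbitrary polytope, which does no harm.\<close>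
  define F where "F = (\<lambda>A. gp_hull (SOME v. good v A)) ` Pow (walls :: ((nat \<Rightarrow> 'n) \<times> nat) set)"
  have "finite F"
    by (simp add: F_def finite_walls)
  moreover have "\<exists>R \<in> F. \<exists>c>0. Q = (*\<^sub>R) c ` R" if Q: "indecomposable_gp Q" "standardized Q" for Q
  proof -
    obtain w where w: "gp_family w" "Q = gp_hull w"
      using Q generalized_permutohedron_iff unfolding indecomposable_gp_def by blast
    have "good w (flat w)"
      using w Q indecomposable_gp_hull_iff[OF w(1)] by (simp add: good_def)
    then have "good (SOME v. good v (flat w)) (flat w)"
      by (rule someI[where P = "\<lambda>v. good v (flat w)"])
    then have "\<exists>c>0. gp_hull w = (*\<^sub>R) c ` gp_hull (SOME v. good v (flat w))"
      using extremal_equivalent_scalar[of "SOME v. good v (flat w)" w] w Q by (simp add: good_def)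
    moreover have "flat w \<in> Pow walls"
      by (auto simp: flat_def)
    ultimately show ?thesis
      using w(2) unfolding F_def by blast
  qed
  ultimately show ?thesis
    by blast
qed

subsection \<open>The linear system\<close>

text \<open>Each \<open>v \<pi>\<close> maximizes all functionals of its chamber. The ends of a
  segment through it must then agree on these functionals, which determine a point.\<close>

lemma gp_hull_extreme_points:
  fixes v :: "(nat \<Rightarrow> 'n::finite) \<Rightarrow> real ^ 'n"
  assumes v: "gp_family v"
  shows "{p. p extreme_point_of gp_hull v} = v ` enumerations"
proof
  show "{p. p extreme_point_of gp_hull v} \<subseteq> v ` enumerations"
    unfolding gp_hull_def by (rule extreme_points_of_convex_hull)
  show "v ` enumerations \<subseteq> {p. p extreme_point_of gp_hull v}"
  proof clarify
    fix \<pi> :: "nat \<Rightarrow> 'n" assume \<pi>: "\<pi> \<in> enumerations"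
    have "v \<pi> \<notin> open_segment a b" if ab: "a \<in> gp_hull v" "b \<in> gp_hull v" for a b
    proof
      assume "v \<pi> \<in> open_segment a b"
      then obtain u where u: "a \<noteq> b" "0 < u" "u < 1" "v \<pi> = (1 - u) *\<^sub>R a + u *\<^sub>R b"
        unfolding in_segment by blast
      have "c \<bullet> a = c \<bullet> b" if c: "sorts c \<pi>" for c
      proof -
        have le: "c \<bullet> a \<le> c \<bullet> v \<pi>" "c \<bullet> b \<le> c \<bullet> v \<pi>"
          using gp_hull_support[OF v \<pi> c] ab by auto
        have eq: "c \<bullet> v \<pi> = (1 - u) * (c \<bullet> a) + u * (c \<bullet> b)"
          using u(4) by (simp add: inner_add_right)
        \<comment> \<open>The two products equal \<open>c \<bullet> v \<pi> - c \<bullet> a\<close>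
          and \<open>c \<bullet> b - c \<bullet> v \<pi>\<close>, so the common factor has both
          signs.\<close>
        have "0 \<le> u * (c \<bullet> b - c \<bullet> a)" "(1 - u) * (c \<bullet> b - c \<bullet> a) \<le> 0"
          using le eq by (simp_all add: algebra_simps)
        then show ?thesis
          using u(2,3) by (simp add: zero_le_mult_iff mult_le_0_iff)
      qed
      then show False
        using sorts_inner_eq_imp_eq[OF \<pi>] u(1) by blast
    qed
    then show "v \<pi> extreme_point_of gp_hull v"
      using gp_hull_vertex[OF \<pi>] by (simp add: extreme_point_of_def)
  qed
qed

text \<open>The normal fan of \<open>v\<close> refines that of \<open>w\<close>: even if
  \<open>\<pi>\<close> does not sort \<open>c\<close>, maximality passes from \<open>v \<pi>\<close>
  to \<open>w \<pi>\<close>. Otherwise the greedy property of the family \<open>M v - w\<close>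
  would fail.\<close>

lemma flat_subset_maximizer:
  assumes v: "gp_family v" and w: "gp_family w" and sub: "flat v \<subseteq> flat w"
    and E: "\<pi> \<in> enumerations" "\<rho> \<in> enumerations" and c: "sorts c \<rho>" "c \<bullet> v \<rho> \<le> c \<bullet> v \<pi>"
  shows "c \<bullet> w \<pi> = c \<bullet> w \<rho>"
proof -
  obtain M where M: "0 < M" "\<And>\<pi> l. (\<pi>, l) \<in> walls \<Longrightarrow> \<bar>slope w \<pi> l\<bar> \<le> M * slope v \<pi> l"
    using flat_subset_dominated[OF v sub] by blast
  have u: "gp_family (\<lambda>\<pi>. M *\<^sub>R v \<pi> - w \<pi>)"
    unfolding gp_family_def slope_linear
    using M(2) v w by (fastforce intro: edge_family_linear simp: gp_family_def)
  have "M * (c \<bullet> v \<pi>) - c \<bullet> w \<pi> \<le> M * (c \<bullet> v \<rho>) - c \<bullet> w \<rho>"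
    using gp_family_greedy[OF u E(2,1) c(1)] by (simp add: inner_diff_right)
  moreover have "M * (c \<bullet> v \<rho>) \<le> M * (c \<bullet> v \<pi>)"
    using M(1) c(2) by simp
  moreover have "c \<bullet> w \<pi> \<le> c \<bullet> w \<rho>"
    by (rule gp_family_greedy[OF w E(2,1) c(1)])
  ultimately show ?thesis
    by simp
qed

lemma flat_subset_tight_sum:
  fixes v w :: "(nat \<Rightarrow> 'n::finite) \<Rightarrow> real ^ 'n"
  assumes v: "gp_family v" and w: "gp_family w" and sub: "flat v \<subseteq> flat w"
    and E: "\<pi> \<in> enumerations" "\<rho> \<in> enumerations" and sorts: "sorts (- indic S) \<rho>"
    and tight: "(\<Sum>i\<in>S. v \<pi> $ i) \<le> (\<Sum>i\<in>S. v \<rho> $ i)"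
  shows "(\<Sum>i\<in>S. w \<pi> $ i) = (\<Sum>i\<in>S. w \<rho> $ i)"
  using flat_subset_maximizer[OF v w sub E sorts] tight by (simp add: indic_inner)

text \<open>A set is tight at a row if the row minimizes the coordinate sum over it, and this passes
  from \<open>v\<close> to \<open>w\<close>. Condition (a) is the case of singletons, where
  standardization makes the minimum 0.\<close>

lemma family_solves_system:
  fixes v w :: "(nat \<Rightarrow> 'n::finite) \<Rightarrow> real ^ 'n"
  assumes v: "gp_family v" and w: "gp_family w" and sub: "flat v \<subseteq> flat w"
    and stv: "standardized (gp_hull v)" and stw: "standardized (gp_hull w)"
    and x: "x ` \<Gamma> = v ` enumerations"
    and rep: "\<And>\<tau>. \<tau> \<in> \<Gamma> \<Longrightarrow> rep \<tau> \<in> enumerations \<and> v (rep \<tau>) = x \<tau>"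
  shows "solves_system \<Gamma> x (\<lambda>\<tau>. w (rep \<tau>))"
  unfolding solves_system_def
proof (intro conjI ballI allI impI)
  fix \<tau> i assume \<tau>: "\<tau> \<in> \<Gamma>" and i: "i \<in> null_set x \<tau>"
  obtain \<rho> where \<rho>: "\<rho> \<in> enumerations" "\<rho> CARD('n) = i"
    using exists_enumeration_last by blast
  have z: "v \<rho> $ i = 0" "w \<rho> $ i = 0"
    using standardized_gp_hull_iff[OF v] standardized_gp_hull_iff[OF w] stv stw \<rho> by auto
  have "axis i 1 = indic {i}"
    by (simp add: vec_eq_iff axis_def indic_def)
  then have "sorts (- indic {i}) \<rho>"
    using sorts_minus_last[OF \<rho>(1)] \<rho>(2) by simp
  then show "w (rep \<tau>) $ i = 0"
    using flat_subset_tight_sum[OF v w sub, of "rep \<tau>" \<rho> "{i}"] rep[OF \<tau>] \<rho>(1) z i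
    by (simp add: null_set_def)
next
  fix S \<tau> \<pi>
  assume \<Gamma>: "\<tau> \<in> \<Gamma>" "\<pi> \<in> \<Gamma>" and S: "S \<in> tight_sets \<Gamma> x \<tau> \<inter> tight_sets \<Gamma> x \<pi>"
  obtain \<rho> where \<rho>: "\<rho> \<in> enumerations" "sorts (- indic S) \<rho>"
    using exists_sorting by blast
  obtain \<sigma> where \<sigma>: "\<sigma> \<in> \<Gamma>" "x \<sigma> = v \<rho>"
    using x \<rho>(1) by (metis imageE imageI)
  have "(\<Sum>i\<in>S. w (rep \<kappa>) $ i) = (\<Sum>i\<in>S. w \<rho> $ i)" if "\<kappa> \<in> \<Gamma>" "S \<in> tight_sets \<Gamma> x \<kappa>" for \<kappa>
    using flat_subset_tight_sum[OF v w sub _ \<rho>, of "rep \<kappa>"] rep[OF that(1)] that(2) \<sigma>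
    by (fastforce simp: tight_sets_def)
  then show "(\<Sum>i\<in>S. w (rep \<tau>) $ i) = (\<Sum>i\<in>S. w (rep \<pi>) $ i)"
    using \<Gamma> S by auto
qed

section \<open>From solutions of the system back to families\<close>

lemma sorts_suffix:
  assumes "sorts (indic A) \<pi>"
  shows "sorts (- indic (- A)) \<pi>"
  using assms by (fastforce simp: sorts_def indic_def)

text \<open>Maximizing the sum over a set amounts to minimizing it over the complement in terms of
  sortedness, so complements of prefixes of \<open>\<pi>\<close> are tight. These are the sets at
  which condition (b) is applied to a solution.\<close>

lemma suffix_in_tight_sets:
  fixes v :: "(nat \<Rightarrow> 'n::finite) \<Rightarrow> real ^ 'n"
  assumes v: "gp_family v" and x: "x ` \<Gamma> = v ` enumerations"
    and \<pi>: "\<pi> \<in> enumerations" "x \<tau> = v \<pi>" and j: "j \<le> CARD('n)"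
  shows "- \<pi> ` {1..j} \<in> tight_sets \<Gamma> x \<tau>"
  unfolding tight_sets_def mem_Collect_eq
proof
  fix \<sigma> assume "\<sigma> \<in> \<Gamma>"
  then obtain \<rho> where \<rho>: "\<rho> \<in> enumerations" "x \<sigma> = v \<rho>"
    using x by (metis imageE imageI)
  show "(\<Sum>i\<in>- \<pi> ` {1..j}. x \<tau> $ i) \<le> (\<Sum>i\<in>- \<pi> ` {1..j}. x \<sigma> $ i)"
    using gp_family_greedy[OF v \<pi>(1) \<rho>(1) sorts_suffix[OF sorts_indic_prefix[OF \<pi>(1) j]]] \<pi>(2) \<rho>(2)
    by (simp add: indic_inner)
qed

lemma solution_prefix_eq:
  fixes v :: "(nat \<Rightarrow> 'n::finite) \<Rightarrow> real ^ 'n"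
  assumes v: "gp_family v" and x: "x ` \<Gamma> = v ` enumerations" and y: "solves_system \<Gamma> x y"
    and \<pi>: "\<pi> \<in> enumerations" "\<tau> \<in> \<Gamma>" "x \<tau> = v \<pi>"
    and \<rho>: "\<rho> \<in> enumerations" "\<sigma> \<in> \<Gamma>" "x \<sigma> = v \<rho>"
    and j: "j \<le> CARD('n)" "\<pi> ` {1..j} = \<rho> ` {1..j}"
  shows "indic (\<pi> ` {1..j}) \<bullet> y \<tau> = indic (\<pi> ` {1..j}) \<bullet> y \<sigma>"
proof -
  have tight: "indic (- \<pi> ` {1..k}) \<bullet> y \<tau> = indic (- \<pi> ` {1..k}) \<bullet> y \<sigma>"
    if "k \<le> CARD('n)" "\<pi> ` {1..k} = \<rho> ` {1..k}" for k
  proof -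
    have "- \<pi> ` {1..k} \<in> tight_sets \<Gamma> x \<tau> \<inter> tight_sets \<Gamma> x \<sigma>"
      using suffix_in_tight_sets[OF v x \<pi>(1,3) that(1)]
        suffix_in_tight_sets[OF v x \<rho>(1,3) that(1)] unfolding that(2) by (rule IntI)
    then show ?thesis
      using y \<pi>(2) \<rho>(2) unfolding solves_system_def indic_inner by blast
  qed
  \<comment> \<open>The prefix \<open>{1..0}\<close> is empty, so its complement is the whole ground
    set and \<open>tight[of 0]\<close> equates the total sums.\<close>
  have "indic (\<pi> ` {1..j}) = indic (- \<pi> ` {1..0}) - indic (- \<pi> ` {1..j})"
    by (simp add: vec_eq_iff indic_def)
  then show ?thesis
    using tight[of 0] tight[OF j] by (simp add: inner_diff_left)
qed

text \<open>A solution read along enumerations is an edge family flat wherever \<open>v\<close> is.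
  Adding a large multiple of \<open>v\<close> moves it into the cone, where extremality
  applies.\<close>

lemma solution_is_multiple:
  fixes v :: "(nat \<Rightarrow> 'n::finite) \<Rightarrow> real ^ 'n"
  assumes v: "gp_family v" and st: "standardized (gp_hull v)" and ex: "extremal v"
    and x: "x ` \<Gamma> = v ` enumerations" and y: "solves_system \<Gamma> x y"
  shows "\<exists>c. \<forall>\<tau> \<in> \<Gamma>. y \<tau> = c *\<^sub>R x \<tau>"
proof -
  have "\<forall>\<pi> \<in> enumerations. \<exists>\<tau>. \<tau> \<in> \<Gamma> \<and> x \<tau> = v \<pi>"
    using x by (metis imageE imageI)
  then obtain rep where rep: "\<And>\<pi>. \<pi> \<in> enumerations \<Longrightarrow> rep \<pi> \<in> \<Gamma>"
    "\<And>\<pi>. \<pi> \<in> enumerations \<Longrightarrow> x (rep \<pi>) = v \<pi>"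
    by metis
  \<comment> \<open>Rows of \<open>x\<close> may repeat; equal rows share all tight prefix
    complements of one \<open>\<pi>\<close>, which forces the rows of \<open>y\<close> to
    agree.\<close>
  have y_eq: "y \<tau> = y \<sigma>" if \<tau>: "\<tau> \<in> \<Gamma>" and \<sigma>: "\<sigma> \<in> \<Gamma>" "x \<tau> = x \<sigma>" for \<tau> \<sigma>
  proof -
    obtain \<pi> where \<pi>: "\<pi> \<in> enumerations" "x \<tau> = v \<pi>"
      using x \<tau> by (metis imageE imageI)
    have "x \<sigma> = v \<pi>"
      using \<sigma>(2) \<pi>(2) by simp
    then show ?thesis
      using prefix_inner_eq_imp_eq[OF \<pi>(1)] solution_prefix_eq[OF v x y \<pi>(1) \<tau> \<pi>(2) \<pi>(1) \<sigma>(1)]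
      by blast
  qed
  define w where "w \<pi> = y (rep \<pi>)" for \<pi>
  have edge: "edge_family w"
    unfolding edge_family_def
  proof safe
    fix \<pi> :: "nat \<Rightarrow> 'n" and l assume "(\<pi>, l) \<in> walls"
    then have \<pi>: "\<pi> \<in> enumerations" and l: "1 \<le> l" "l < CARD('n)"
      by (auto simp: walls_def)
    note E = swap_at_enumerations[OF \<pi> l]
    have "indic (\<pi> ` {1..j}) \<bullet> (w \<pi> - w (swap_at \<pi> l)) = 0" if "j \<le> CARD('n)" "j \<noteq> l" for j
      using solution_prefix_eq[OF v x y \<pi> rep(1,2)[OF \<pi>] E rep(1,2)[OF E] that(1)
          swap_at_image[OF that(2) l(1), symmetric]]
      by (simp add: w_def inner_diff_right)
    from edge_of_prefixes(1)[OF \<pi> l this]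
    show "w \<pi> - w (swap_at \<pi> l) = slope w \<pi> l *\<^sub>R (axis (\<pi> l) 1 - axis (\<pi> (l + 1)) 1)"
      unfolding slope_def .
  qed
  have flat: "flat v \<subseteq> flat w"
  proof safe
    fix \<pi> l assume "(\<pi>, l) \<in> flat v"
    then have wall: "(\<pi>, l) \<in> walls" and z: "slope v \<pi> l = 0"
      by (auto simp: flat_def)
    then have E: "\<pi> \<in> enumerations" "swap_at \<pi> l \<in> enumerations"
      using swap_at_enumerations by (auto simp: walls_def)
    have "v \<pi> - v (swap_at \<pi> l) = 0"
      using gp_family_edge[OF v] wall z by (auto simp: edge_family_def)
    \<comment> \<open>The two enumerations give the same row of \<open>x\<close>, possibly under
      different indices.\<close>
    then have "w \<pi> = w (swap_at \<pi> l)"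
      unfolding w_def using rep E by (intro y_eq) auto
    then show "(\<pi>, l) \<in> flat w"
      using wall by (simp add: flat_def slope_def)
  qed
  have zv: "\<forall>\<pi> \<in> enumerations. v \<pi> $ \<pi> CARD('n) = 0"
    using standardized_gp_hull_iff[OF v] st by simp
  then have zw: "\<forall>\<pi> \<in> enumerations. w \<pi> $ \<pi> CARD('n) = 0"
    using y rep by (simp add: solves_system_def null_set_def w_def)
  obtain M where M: "0 < M" "\<And>\<pi> l. (\<pi>, l) \<in> walls \<Longrightarrow> \<bar>slope w \<pi> l\<bar> \<le> M * slope v \<pi> l"
    using flat_subset_dominated[OF v flat] by blast
  let ?u = "\<lambda>\<pi>. M *\<^sub>R v \<pi> + w \<pi>"
  have "gp_family ?u"
    unfolding gp_family_def slope_linear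
    using M(2) gp_family_edge[OF v] edge by (fastforce intro: edge_family_linear)
  moreover have "flat v \<subseteq> flat ?u"
    using flat by (auto simp: flat_def slope_linear)
  ultimately obtain c t where ct: "\<And>\<pi>. \<pi> \<in> enumerations \<Longrightarrow> ?u \<pi> = c *\<^sub>R v \<pi> + t"
    using ex unfolding extremal_def by blast
  have "t = 0"
    using standardized_affine_imp_scalar[OF zv _ ct] zv zw by simp
  then have w: "w \<pi> = (c - M) *\<^sub>R v \<pi>" if "\<pi> \<in> enumerations" for \<pi>
    using ct[OF that] by (simp add: algebra_simps)
  have "y \<tau> = (c - M) *\<^sub>R x \<tau>" if \<tau>: "\<tau> \<in> \<Gamma>" for \<tau>
  proof -
    obtain \<pi> where \<pi>: "\<pi> \<in> enumerations" "x \<tau> = v \<pi>"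
      using x \<tau> by (metis imageE imageI)
    have "y \<tau> = w \<pi>"
      unfolding w_def using y_eq[OF \<tau> rep(1)[OF \<pi>(1)]] rep(2)[OF \<pi>(1)] \<pi>(2) by simp
    then show ?thesis
      using w[OF \<pi>(1)] \<pi>(2) by simp
  qed
  then show ?thesis
    by blast
qed

lemma gp_family_standardize:
  fixes w :: "(nat \<Rightarrow> 'n::finite) \<Rightarrow> real ^ 'n"
  assumes w: "gp_family w"
  obtains t where "gp_family (\<lambda>\<pi>. w \<pi> - t)" "standardized (gp_hull (\<lambda>\<pi>. w \<pi> - t))"
proof -
  have "\<forall>i. \<exists>\<pi>. \<pi> \<in> enumerations \<and> \<pi> CARD('n) = (i :: 'n)"
    using exists_enumeration_last by metis
  then obtain e where e: "\<And>i :: 'n. e i \<in> enumerations \<and> e i CARD('n) = i"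
    by metis
  \<comment> \<open>Since \<open>e i\<close> ends in \<open>i\<close>, this entry is the minimum of
    coordinate \<open>i\<close> over the hull.\<close>
  define t :: "real ^ 'n" where "t = (\<chi> i. w (e i) $ i)"
  have gp: "gp_family (\<lambda>\<pi>. w \<pi> - t)"
    using gp_family_add[OF w gp_family_const[of "- t"]] by simp
  moreover have "(w \<pi> - t) $ \<pi> CARD('n) = 0" if \<pi>: "\<pi> \<in> enumerations" for \<pi>
    using gp_hull_last_minimal[OF w \<pi> gp_hull_vertex] gp_hull_last_minimal[OF w _ gp_hull_vertex[OF \<pi>]]
      e[of "\<pi> CARD('n)"]
    by (fastforce simp: t_def intro: order_antisym)
  ultimately show ?thesis
    using that standardized_gp_hull_iff[OF gp] by blast
qed

text \<open>For the converse, every family in the face of \<open>v\<close> becomes a solution after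
  standardizing translation, and the translation reappears as the constant in
  \<open>extremal\<close>.\<close>

lemma extremal_iff_solutions:
  fixes v :: "(nat \<Rightarrow> 'n::finite) \<Rightarrow> real ^ 'n"
  assumes v: "gp_family v" and st: "standardized (gp_hull v)" and x: "x ` \<Gamma> = v ` enumerations"
  shows "extremal v \<longleftrightarrow> (\<forall>y. solves_system \<Gamma> x y \<longrightarrow> (\<exists>c. \<forall>\<tau> \<in> \<Gamma>. y \<tau> = c *\<^sub>R x \<tau>))"
proof
  assume "extremal v"
  then show "\<forall>y. solves_system \<Gamma> x y \<longrightarrow> (\<exists>c. \<forall>\<tau> \<in> \<Gamma>. y \<tau> = c *\<^sub>R x \<tau>)"
    using solution_is_multiple[OF v st _ x] by blast
next
  assume sol: "\<forall>y. solves_system \<Gamma> x y \<longrightarrow> (\<exists>c. \<forall>\<tau> \<in> \<Gamma>. y \<tau> = c *\<^sub>R x \<tau>)"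
  have "\<forall>\<tau> \<in> \<Gamma>. \<exists>\<pi>. \<pi> \<in> enumerations \<and> v \<pi> = x \<tau>"
    using x by (metis imageE imageI)
  then obtain rep where rep: "\<And>\<tau>. \<tau> \<in> \<Gamma> \<Longrightarrow> rep \<tau> \<in> enumerations \<and> v (rep \<tau>) = x \<tau>"
    by metis
  show "extremal v"
    unfolding extremal_def
  proof (intro allI impI)
    fix w assume w: "gp_family w \<and> flat v \<subseteq> flat w"
    then obtain t where t: "gp_family (\<lambda>\<pi>. w \<pi> - t)" "standardized (gp_hull (\<lambda>\<pi>. w \<pi> - t))"
      using gp_family_standardize by blast
    let ?u = "\<lambda>\<pi>. w \<pi> - t"
    have sub: "flat v \<subseteq> flat ?u"
      using w by (auto simp: flat_def slope_linear)
    obtain c where c: "\<And>\<tau>. \<tau> \<in> \<Gamma> \<Longrightarrow> ?u (rep \<tau>) = c *\<^sub>R x \<tau>"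
      using sol family_solves_system[OF v t(1) sub st t(2) x rep] by blast
    have "w \<pi> = c *\<^sub>R v \<pi> + t" if \<pi>: "\<pi> \<in> enumerations" for \<pi>
    proof -
      obtain \<tau> where \<tau>: "\<tau> \<in> \<Gamma>" "x \<tau> = v \<pi>"
        using x \<pi> by (metis imageE imageI)
      \<comment> \<open>The enumerations \<open>rep \<tau>\<close> and \<open>\<pi>\<close> may
        differ, but \<open>v\<close> agrees on them, so both values of \<open>?u\<close> maximize
        every functional sorted by \<open>\<pi>\<close>.\<close>
      have "?u (rep \<tau>) = ?u \<pi>"
      proof (rule sorts_inner_eq_imp_eq[OF \<pi>])
        fix a assume a: "sorts a \<pi>"
        show "a \<bullet> ?u (rep \<tau>) = a \<bullet> ?u \<pi>"
          by (rule flat_subset_maximizer[OF v t(1) sub _ \<pi> a]) (use rep[OF \<tau>(1)] \<tau>(2) in auto)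
      qed
      then show ?thesis
        using c[OF \<tau>(1)] \<tau>(2) by (simp add: algebra_simps)
    qed
    then show "\<exists>c t. \<forall>\<pi>\<in>enumerations. w \<pi> = c *\<^sub>R v \<pi> + t"
      by blast
  qed
qed

theorem theorem2:
  fixes P :: "(real ^ 'n::finite) set"
    and \<Gamma> :: "'g set"
    and x :: "'g \<Rightarrow> real ^ 'n"
  assumes "CARD('n) \<ge> 2"
    and "generalized_permutohedron P" and "standardized P"
    and "finite \<Gamma>" and "x ` \<Gamma> = {v. v extreme_point_of P}"
  shows "(indecomposable_gp P \<longleftrightarrow>
            (\<forall>y. solves_system \<Gamma> x y \<longrightarrow> (\<exists>c. \<forall>\<tau> \<in> \<Gamma>. y \<tau> = c *\<^sub>R x \<tau>)))
       \<and> (indecomposable_gp P \<longrightarrow>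
            (\<forall>Q. generalized_permutohedron Q \<and> standardized Q \<and> summand_equivalent Q P
                 \<longleftrightarrow> (\<exists>c>0. Q = (*\<^sub>R) c ` P)))
       \<and> (\<exists>F :: (real ^ 'n) set set. finite F \<and>
            (\<forall>Q. indecomposable_gp Q \<and> standardized Q \<longrightarrow>
                 (\<exists>R \<in> F. \<exists>c>0. Q = (*\<^sub>R) c ` R)))
       \<and> (\<forall>Q :: (real ^ 'n) set. generalized_permutohedron Q \<longrightarrow>
            (\<exists>Rs. Rs \<noteq> [] \<and> (\<forall>R \<in> set Rs. indecomposable_gp R) \<and> Q = sum_list Rs))"
proof -
  obtain v where v: "gp_family v" "P = gp_hull v"
    using assms(2) generalized_permutohedron_iff by blast
  have x: "x ` \<Gamma> = v ` enumerations"
    using assms(5) gp_hull_extreme_points[OF v(1)] v(2) by simp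
  have "indecomposable_gp P \<longleftrightarrow>
      (\<forall>y. solves_system \<Gamma> x y \<longrightarrow> (\<exists>c. \<forall>\<tau> \<in> \<Gamma>. y \<tau> = c *\<^sub>R x \<tau>))"
    using indecomposable_gp_hull_iff[OF v(1)] extremal_iff_solutions[OF v(1) _ x] assms(3)
    unfolding v(2) by blast
  moreover have "indecomposable_gp P \<longrightarrow>
      (\<forall>Q. generalized_permutohedron Q \<and> standardized Q \<and> summand_equivalent Q P
         \<longleftrightarrow> (\<exists>c>0. Q = (*\<^sub>R) c ` P))"
    using standardized_equivalent_iff assms(3) by blast
  moreover have "\<forall>Q :: (real ^ 'n) set. generalized_permutohedron Q \<longrightarrow>
      (\<exists>Rs. Rs \<noteq> [] \<and> (\<forall>R \<in> set Rs. indecomposable_gp R) \<and> Q = sum_list Rs)"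
    using gp_hull_sum_indecomposable generalized_permutohedron_iff by metis
  ultimately show ?thesis
    using finitely_many_indecomposable by blast
qed

end
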